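(* Let $p^s,p^t$ be the empirical source and target data distributions and for $t\in[0,1]$ let $p(x,t)=(1-t)\,p^s(x)+t\,p^t(x)$. Let $t\mapsto(\lambda(t),\gamma(t))$ be a smooth path with velocities $(\dot\lambda,\dot\gamma)$, and let $t\mapsto\theta(t)$ be a smooth path with $\theta(t)$ in the equilibrium set $\Theta_{\lambda(t),\gamma(t)}$ for the data distribution $p(\cdot,t)$. Assume that along the path $A=\nabla_\theta^2J$ is invertible, $\frac{d}{dt}\nabla_\theta J=0$ and $\frac{d}{dt}C=0$. Then $$\dot\theta=\theta_\lambda\dot\lambda+\theta_\gamma\dot\gamma+\theta_t,\qquad0=C_\lambda\dot\lambda+C_\gamma\dot\gamma+C_t,$$ where $\theta_\lambda=-A^{-1}\frac{\partial}{\partial\lambda}\nabla_\theta J$, $\theta_\gamma=-A^{-1}\frac{\partial}{\partial\gamma}\nabla_\theta J$, $\theta_t=-A^{-1}\int\frac{\partial p(x,t)}{\partial t}\langle\nabla_\theta H\rangle\,dx$, and, with $\ell=\log c_\theta(y_x|z)$, $$C_\lambda=-\mathbb{E}_{x\sim p(x,t)}\Big[\Big\langle\frac{\partial H}{\partial\lambda}\Big\rangle\langle\ell\rangle-\Big\langle\frac{\partial H}{\partial\lambda}\,\ell\Big\rangle+\langle\theta_\lambda^\top\nabla_\theta H\rangle\langle\ell\rangle-\langle\ell\,\theta_\lambda^\top\nabla_\theta H\rangle+\langle\theta_\lambda^\top\nabla_\theta\ell\rangle\Big],$$ $$C_\gamma=-\mathbb{E}_{x\sim p(x,t)}\Big[\Big\langle\frac{\partial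 H}{\partial\gamma}\Big\rangle\langle\ell\rangle-\Big\langle\frac{\partial H}{\partial\gamma}\,\ell\Big\rangle+\langle\theta_\gamma^\top\nabla_\theta H\rangle\langle\ell\rangle-\langle\ell\,\theta_\gamma^\top\nabla_\theta H\rangle+\langle\theta_\gamma^\top\nabla_\theta\ell\rangle\Big],$$ $$C_t=-\int\frac{\partial p(x,t)}{\partial t}\langle\ell\rangle\,dx-\mathbb{E}_{x\sim p(x,t)}\Big[\langle\theta_t^\top\nabla_\theta H\rangle\langle\ell\rangle-\langle\theta_t^\top\nabla_\theta H\;\ell\rangle+\langle\theta_t^\top\nabla_\theta\ell\rangle\Big].$$ Consequently, where $C_\gamma\neq0$, $$\dot\theta=\Big(\theta_\lambda-\frac{C_\lambda}{C_\gamma}\theta_\gamma\Big)\dot\lambda+\Big(\theta_t-\frac{C_t}{C_\gamma}\theta_\gamma\Big).$$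
   Context: The source and target samples are $x^s_1,\dots,x^s_{n_s}$ and $x^t_1,\dots,x^t_{n_t}$, in the same input domain, with $p^s(x)=\frac1{n_s}\sum_{i}\delta_{x-x^s_i}$ and $p^t(x)=\frac1{n_t}\sum_i\delta_{x-x^t_i}$ (the superscript $t$ means "target"; elsewhere $t\in[0,1]$ is time). Thus $\partial p(x,t)/\partial t=p^t-p^s$ as a signed measure. Each datum $x$ has a fixed deterministic label $y_x$, not interpolated. For parameters $\theta\in\Theta\subseteq\mathbb{R}^N$ there are a density $m_\theta(z)$ on latent codes $z$, a decoder density $d_\theta(x|z)$ and a classifier $c_\theta(y|z)$, all positive and smooth in $\theta$. The Hamiltonian is $$H(z;x,\theta,\lambda,\gamma)=-\log m_\theta(z)-\lambda\log d_\theta(x|z)-\gamma\log c_\theta(y_x|z),$$ and $Z_{\theta,x}=\int e^{-H}dz$, assumed finite. Define $J(\theta,\lambda,\gamma,t)=-\mathbb{E}_{x\sim p(x,t)}[\log Z_{\theta,x}]$; the equilibrium set for the data distribution $p(\cdot,t)$ is the set $\Theta_{\lambda,\gamma}$ of minimizers of $J(\cdot,\lambda,\gamma,t)$ over $\Theta$, on which $\nabla_\theta J=0$. For fixed $x$, $\langle\varphi\rangle=\int\varphi\,e^{-H}dz\big/\int e^{-H}dz$ is the Gibbs average over $z$, i.e. the average under the optimal encoder $e(z|x)=e^{-H}/Z_{\theta,x}$. The classification loss is $C=C(\theta,\lambda,\gamma,t)=-\mathbb{E}_{x\sim p(x,t)}\langle\ell\rangle$. Enough regularity and integrability is assumed to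 differentiate under the integral over $z$. *)

theory Defs
  imports "HOL-Probability.Probability"
begin

section \<open>Calculus\<close>

text \<open>Derivatives are taken within \<open>S\<close>, so that the notion applies both to open sets and to
  the closed time interval \<open>{0..1}\<close>. On more general sets \<open>frechet_derivative\<close> need not be unique.\<close>

primrec Ck_on :: "nat \<Rightarrow> 'a::real_normed_vector set \<Rightarrow> ('a \<Rightarrow> 'b::real_normed_vector) \<Rightarrow> bool" where
  "Ck_on 0 S f \<longleftrightarrow> continuous_on S f"
| "Ck_on (Suc k) S f \<longleftrightarrow> f differentiable_on S \<and>
     (\<forall>v. Ck_on k S (\<lambda>a. frechet_derivative f (at a within S) v))"

definition smooth_on :: "'a::real_normed_vector set \<Rightarrow> ('a \<Rightarrow> 'b::real_normed_vector) \<Rightarrow> bool" where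
  "smooth_on S f \<longleftrightarrow> (\<forall>k. Ck_on k S f)"

definition gradient :: "(real^'n \<Rightarrow> real) \<Rightarrow> real^'n \<Rightarrow> real^'n" where
  "gradient f \<theta> = (\<chi> i. frechet_derivative f (at \<theta>) (axis i 1))"

definition hessian :: "(real^'n \<Rightarrow> real) \<Rightarrow> real^'n \<Rightarrow> real^'n^'n" where
  "hessian f \<theta> = jacobian (gradient f) (at \<theta>)"

section \<open>Interpolated data distribution\<close>

definition empirical :: "'x list \<Rightarrow> 'x pmf" where
  "empirical xs = pmf_of_multiset (mset xs)"

text \<open>The distributions are finite combinations of point masses, so \<open>p(x,t)\<close> and
  \<open>\<partial>p(x,t)/\<partial>t\<close> are represented by their densities with respect to counting measure;
  \<open>data_integral w f\<close> is \<open>\<integral> w(x) f(x) dx\<close> in this sense.\<close>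

definition data_mass :: "'x list \<Rightarrow> 'x list \<Rightarrow> real \<Rightarrow> 'x \<Rightarrow> real" where
  "data_mass xs xt t x = (1 - t) * pmf (empirical xs) x + t * pmf (empirical xt) x"

definition data_integral ::
  "('x \<Rightarrow> real) \<Rightarrow> ('x \<Rightarrow> 'b::{banach, second_countable_topology}) \<Rightarrow> 'b" where
  "data_integral w f = (\<integral>x. w x *\<^sub>R f x \<partial>count_space UNIV)"

definition data_expectation ::
  "'x list \<Rightarrow> 'x list \<Rightarrow> real \<Rightarrow> ('x \<Rightarrow> 'b::{banach, second_countable_topology}) \<Rightarrow> 'b" where
  "data_expectation xs xt t f = data_integral (data_mass xs xt t) f"

definition data_velocity :: "'x list \<Rightarrow> 'x list \<Rightarrow> real \<Rightarrow> 'x \<Rightarrow> real" where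
  "data_velocity xs xt t x = deriv (\<lambda>s. data_mass xs xt s x) t"

section \<open>The model\<close>

text \<open>\<open>latent_measure\<close> and \<open>input_measure\<close> are the reference measures \<open>dz\<close> and \<open>dx\<close>
  (for instance \<open>lborel\<close>) with respect to which \<open>prior\<close> and \<open>decoder\<close> are densities.
  \<open>decoder M \<theta> z x\<close> is \<open>d\<^sub>\<theta>(x|z)\<close> and \<open>classifier M \<theta> z y\<close> is \<open>c\<^sub>\<theta>(y|z)\<close>.\<close>

record ('n, 'x, 'y, 'z) model =
  latent_measure :: "'z measure"
  input_measure :: "'x measure"
  prior :: "real^'n \<Rightarrow> 'z \<Rightarrow> real"
  decoder :: "real^'n \<Rightarrow> 'z \<Rightarrow> 'x \<Rightarrow> real"
  classifier :: "real^'n \<Rightarrow> 'z \<Rightarrow> 'y \<Rightarrow> real"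
  label :: "'x \<Rightarrow> 'y"

text \<open>\<open>\<Theta>\<close> is the parameter set and \<open>U\<close> an open set containing it, on which derivatives in
  \<open>\<theta>\<close> make sense; \<open>U = \<Theta>\<close> is allowed when \<open>\<Theta>\<close> is open.\<close>

definition model_on ::
  "(real^'n) set \<Rightarrow> (real^'n) set \<Rightarrow> ('n::finite, 'x, 'y::finite, 'z) model \<Rightarrow> bool" where
  "model_on \<Theta> U M \<longleftrightarrow>
     open U \<and> \<Theta> \<subseteq> U \<and>
     (\<forall>\<theta>\<in>\<Theta>. (\<integral>z. prior M \<theta> z \<partial>latent_measure M) = 1 \<and>
       (\<forall>z\<in>space (latent_measure M).
          (\<integral>x. decoder M \<theta> z x \<partial>input_measure M) = 1 \<and> (\<Sum>y\<in>UNIV. classifier M \<theta> z y) = 1)) \<and>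
     (\<forall>\<theta>\<in>U. prior M \<theta> \<in> borel_measurable (latent_measure M) \<and>
       (\<forall>x\<in>space (input_measure M).
          (\<lambda>z. decoder M \<theta> z x) \<in> borel_measurable (latent_measure M)) \<and>
       (\<forall>y. (\<lambda>z. classifier M \<theta> z y) \<in> borel_measurable (latent_measure M))) \<and>
     (\<forall>z\<in>space (latent_measure M).
       (\<forall>\<theta>\<in>U. prior M \<theta> z > 0 \<and> (\<forall>x\<in>space (input_measure M). decoder M \<theta> z x > 0) \<and>
          (\<forall>y. classifier M \<theta> z y > 0)) \<and>
       smooth_on U (\<lambda>\<theta>. prior M \<theta> z) \<and>
       (\<forall>x\<in>space (input_measure M). smooth_on U (\<lambda>\<theta>. decoder M \<theta> z x)) \<and>
       (\<forall>y. smooth_on U (\<lambda>\<theta>. classifier M \<theta> z y)))"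

definition loglik :: "('n::finite, 'x, 'y, 'z) model \<Rightarrow> 'x \<Rightarrow> real^'n \<Rightarrow> 'z \<Rightarrow> real" where
  "loglik M x \<theta> z = ln (classifier M \<theta> z (label M x))"

definition hamiltonian ::
  "('n::finite, 'x, 'y, 'z) model \<Rightarrow> 'x \<Rightarrow> real^'n \<Rightarrow> real \<Rightarrow> real \<Rightarrow> 'z \<Rightarrow> real" where
  "hamiltonian M x \<theta> l g z =
     - ln (prior M \<theta> z) - l * ln (decoder M \<theta> z x) - g * ln (classifier M \<theta> z (label M x))"

definition partition_fun ::
  "('n::finite, 'x, 'y, 'z) model \<Rightarrow> 'x \<Rightarrow> real^'n \<Rightarrow> real \<Rightarrow> real \<Rightarrow> real" where
  "partition_fun M x \<theta> l g = (\<integral>z. exp (- hamiltonian M x \<theta> l g z) \<partial>latent_measure M)"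

definition gibbs :: "('n::finite, 'x, 'y, 'z) model \<Rightarrow> 'x \<Rightarrow> real^'n \<Rightarrow> real \<Rightarrow> real \<Rightarrow>
    ('z \<Rightarrow> 'b::{banach, second_countable_topology}) \<Rightarrow> 'b" where
  "gibbs M x \<theta> l g \<phi> =
     (\<integral>z. exp (- hamiltonian M x \<theta> l g z) *\<^sub>R \<phi> z \<partial>latent_measure M) /\<^sub>R partition_fun M x \<theta> l g"

definition H_lam ::
  "('n::finite, 'x, 'y, 'z) model \<Rightarrow> 'x \<Rightarrow> real^'n \<Rightarrow> real \<Rightarrow> real \<Rightarrow> 'z \<Rightarrow> real" where
  "H_lam M x \<theta> l g z = deriv (\<lambda>l'. hamiltonian M x \<theta> l' g z) l"

definition H_gam ::
  "('n::finite, 'x, 'y, 'z) model \<Rightarrow> 'x \<Rightarrow> real^'n \<Rightarrow> real \<Rightarrow> real \<Rightarrow> 'z \<Rightarrow> real" where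
  "H_gam M x \<theta> l g z = deriv (\<lambda>g'. hamiltonian M x \<theta> l g' z) g"

definition H_grad ::
  "('n::finite, 'x, 'y, 'z) model \<Rightarrow> 'x \<Rightarrow> real^'n \<Rightarrow> real \<Rightarrow> real \<Rightarrow> 'z \<Rightarrow> real^'n" where
  "H_grad M x \<theta> l g z = gradient (\<lambda>\<theta>'. hamiltonian M x \<theta>' l g z) \<theta>"

definition loglik_grad ::
  "('n::finite, 'x, 'y, 'z) model \<Rightarrow> 'x \<Rightarrow> real^'n \<Rightarrow> 'z \<Rightarrow> real^'n" where
  "loglik_grad M x \<theta> z = gradient (\<lambda>\<theta>'. loglik M x \<theta>' z) \<theta>"

section \<open>Free energy, equilibrium set, classification loss\<close>

definition J :: "('n::finite, 'x, 'y, 'z) model \<Rightarrow> 'x list \<Rightarrow> 'x list \<Rightarrow>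
    real^'n \<Rightarrow> real \<Rightarrow> real \<Rightarrow> real \<Rightarrow> real" where
  "J M xs xt \<theta> l g t = - data_expectation xs xt t (\<lambda>x. ln (partition_fun M x \<theta> l g))"

definition J_grad :: "('n::finite, 'x, 'y, 'z) model \<Rightarrow> 'x list \<Rightarrow> 'x list \<Rightarrow>
    real^'n \<Rightarrow> real \<Rightarrow> real \<Rightarrow> real \<Rightarrow> real^'n" where
  "J_grad M xs xt \<theta> l g t = gradient (\<lambda>\<theta>'. J M xs xt \<theta>' l g t) \<theta>"

definition J_hess :: "('n::finite, 'x, 'y, 'z) model \<Rightarrow> 'x list \<Rightarrow> 'x list \<Rightarrow>
    real^'n \<Rightarrow> real \<Rightarrow> real \<Rightarrow> real \<Rightarrow> real^'n^'n" where
  "J_hess M xs xt \<theta> l g t = hessian (\<lambda>\<theta>'. J M xs xt \<theta>' l g t) \<theta>"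

definition equilibrium_set :: "(real^'n) set \<Rightarrow> ('n::finite, 'x, 'y, 'z) model \<Rightarrow> 'x list \<Rightarrow> 'x list \<Rightarrow>
    real \<Rightarrow> real \<Rightarrow> real \<Rightarrow> (real^'n) set" where
  "equilibrium_set \<Theta> M xs xt l g t =
     {\<theta>. is_arg_min (\<lambda>\<theta>'. J M xs xt \<theta>' l g t) (\<lambda>\<theta>'. \<theta>' \<in> \<Theta>) \<theta>}"

definition class_loss :: "('n::finite, 'x, 'y, 'z) model \<Rightarrow> 'x list \<Rightarrow> 'x list \<Rightarrow>
    real^'n \<Rightarrow> real \<Rightarrow> real \<Rightarrow> real \<Rightarrow> real" where
  "class_loss M xs xt \<theta> l g t =
     - data_expectation xs xt t (\<lambda>x. gibbs M x \<theta> l g (loglik M x \<theta>))"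

section \<open>Regularity for differentiating under the integral over \<open>z\<close>\<close>

definition locally_dominated ::
  "'z measure \<Rightarrow> 'q::metric_space set \<Rightarrow> ('q \<Rightarrow> 'z \<Rightarrow> real) \<Rightarrow> bool" where
  "locally_dominated \<mu> D f \<longleftrightarrow>
     (\<forall>q0\<in>D. \<exists>e>0. \<exists>h. integrable \<mu> h \<and>
        (AE z in \<mu>. \<forall>q\<in>D \<inter> ball q0 e. \<bar>f q z\<bar> \<le> h z))"

definition weight :: "('n::finite, 'x, 'y, 'z) model \<Rightarrow> 'x \<Rightarrow> (real^'n) \<times> real \<times> real \<Rightarrow> 'z \<Rightarrow> real" where
  "weight M x q z = (case q of (\<theta>, l, g) \<Rightarrow> exp (- hamiltonian M x \<theta> l g z))"

definition dir_deriv ::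
  "'q::real_normed_vector \<Rightarrow> ('q \<Rightarrow> 'z \<Rightarrow> real) \<Rightarrow> 'q \<Rightarrow> 'z \<Rightarrow> real" where
  "dir_deriv v f q z = frechet_derivative (\<lambda>q'. f q' z) (at q) v"

text \<open>Since \<open>\<partial>e\<^sup>-\<^sup>H/\<partial>\<gamma> = \<ell> e\<^sup>-\<^sup>H\<close>, the bound on second derivatives of \<open>e\<^sup>-\<^sup>H\<close> also covers the first
  derivatives of \<open>\<ell> e\<^sup>-\<^sup>H\<close>. It does not make \<open>\<langle>\<nabla>\<ell>\<rangle>\<close> and \<open>\<langle>\<ell> \<nabla>H\<rangle>\<close> separately finite, hence the
  last clause.\<close>

definition regular_integrals ::
  "((real^'n) \<times> real \<times> real) set \<Rightarrow> ('n::finite, 'x, 'y, 'z) model \<Rightarrow> 'x \<Rightarrow> bool" where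
  "regular_integrals D M x \<longleftrightarrow>
     (\<forall>u. locally_dominated (latent_measure M) D (dir_deriv u (weight M x))) \<and>
     (\<forall>u v. locally_dominated (latent_measure M) D (dir_deriv v (dir_deriv u (weight M x)))) \<and>
     (\<forall>(\<theta>, l, g)\<in>D. integrable (latent_measure M)
        (\<lambda>z. exp (- hamiltonian M x \<theta> l g z) *\<^sub>R loglik_grad M x \<theta> z))"

section \<open>Response coefficients\<close>

definition theta_lam :: "('n::finite, 'x, 'y, 'z) model \<Rightarrow> 'x list \<Rightarrow> 'x list \<Rightarrow>
    real^'n \<Rightarrow> real \<Rightarrow> real \<Rightarrow> real \<Rightarrow> real^'n" where
  "theta_lam M xs xt \<theta> l g t =
     - (matrix_inv (J_hess M xs xt \<theta> l g t) *v
        vector_derivative (\<lambda>l'. J_grad M xs xt \<theta> l' g t) (at l))"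

definition theta_gam :: "('n::finite, 'x, 'y, 'z) model \<Rightarrow> 'x list \<Rightarrow> 'x list \<Rightarrow>
    real^'n \<Rightarrow> real \<Rightarrow> real \<Rightarrow> real \<Rightarrow> real^'n" where
  "theta_gam M xs xt \<theta> l g t =
     - (matrix_inv (J_hess M xs xt \<theta> l g t) *v
        vector_derivative (\<lambda>g'. J_grad M xs xt \<theta> l g' t) (at g))"

definition theta_t :: "('n::finite, 'x, 'y, 'z) model \<Rightarrow> 'x list \<Rightarrow> 'x list \<Rightarrow>
    real^'n \<Rightarrow> real \<Rightarrow> real \<Rightarrow> real \<Rightarrow> real^'n" where
  "theta_t M xs xt \<theta> l g t =
     - (matrix_inv (J_hess M xs xt \<theta> l g t) *v
        data_integral (data_velocity xs xt t) (\<lambda>x. gibbs M x \<theta> l g (H_grad M x \<theta> l g)))"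

definition C_lam :: "('n::finite, 'x, 'y, 'z) model \<Rightarrow> 'x list \<Rightarrow> 'x list \<Rightarrow>
    real^'n \<Rightarrow> real \<Rightarrow> real \<Rightarrow> real \<Rightarrow> real" where
  "C_lam M xs xt \<theta> l g t =
     (let v = theta_lam M xs xt \<theta> l g t in
      - data_expectation xs xt t (\<lambda>x.
          let avg = gibbs M x \<theta> l g; ll = loglik M x \<theta>; Hl = H_lam M x \<theta> l g;
              gH = H_grad M x \<theta> l g; gll = loglik_grad M x \<theta>
          in avg Hl * avg ll - avg (\<lambda>z. Hl z * ll z)
             + avg (\<lambda>z. v \<bullet> gH z) * avg ll - avg (\<lambda>z. ll z * (v \<bullet> gH z))
             + avg (\<lambda>z. v \<bullet> gll z)))"

definition C_gam :: "('n::finite, 'x, 'y, 'z) model \<Rightarrow> 'x list \<Rightarrow> 'x list \<Rightarrow>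
    real^'n \<Rightarrow> real \<Rightarrow> real \<Rightarrow> real \<Rightarrow> real" where
  "C_gam M xs xt \<theta> l g t =
     (let v = theta_gam M xs xt \<theta> l g t in
      - data_expectation xs xt t (\<lambda>x.
          let avg = gibbs M x \<theta> l g; ll = loglik M x \<theta>; Hg = H_gam M x \<theta> l g;
              gH = H_grad M x \<theta> l g; gll = loglik_grad M x \<theta>
          in avg Hg * avg ll - avg (\<lambda>z. Hg z * ll z)
             + avg (\<lambda>z. v \<bullet> gH z) * avg ll - avg (\<lambda>z. ll z * (v \<bullet> gH z))
             + avg (\<lambda>z. v \<bullet> gll z)))"

definition C_t :: "('n::finite, 'x, 'y, 'z) model \<Rightarrow> 'x list \<Rightarrow> 'x list \<Rightarrow>
    real^'n \<Rightarrow> real \<Rightarrow> real \<Rightarrow> real \<Rightarrow> real" where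
  "C_t M xs xt \<theta> l g t =
     (let v = theta_t M xs xt \<theta> l g t in
      - data_integral (data_velocity xs xt t) (\<lambda>x. gibbs M x \<theta> l g (loglik M x \<theta>))
      - data_expectation xs xt t (\<lambda>x.
          let avg = gibbs M x \<theta> l g; ll = loglik M x \<theta>;
              gH = H_grad M x \<theta> l g; gll = loglik_grad M x \<theta>
          in avg (\<lambda>z. v \<bullet> gH z) * avg ll - avg (\<lambda>z. (v \<bullet> gH z) * ll z)
             + avg (\<lambda>z. v \<bullet> gll z)))"

end

theory Submission
  imports Defs
begin

text \<open>Both \<open>-\<nabla>\<^sub>\<theta> J\<close> and \<open>-C\<close> are data averages of \<open>\<partial>Z / Z\<close> for first-order derivatives \<open>\<partial>\<close>: in a direction of \<open>\<theta>\<close>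
  for the gradient, and in \<open>\<gamma>\<close> for the loss, because \<open>\<ell> e\<^sup>-\<^sup>H = \<partial>e\<^sup>-\<^sup>H/\<partial>\<gamma>\<close>. So one result on differentiation
  under the integral, applied to \<open>e\<^sup>-\<^sup>H\<close> and to its directional derivatives, makes both of them jointly
  differentiable in \<open>(\<theta>, \<lambda>, \<gamma>, t)\<close>. The chain rule along the path turns stationarity of \<open>\<nabla>\<^sub>\<theta> J\<close> into
  \<open>A \<theta>' + \<lambda>' \<partial>\<^sub>\<lambda>\<nabla>J + \<gamma>' \<partial>\<^sub>\<gamma>\<nabla>J + \<partial>\<^sub>t\<nabla>J = 0\<close>, which is solved for \<open>\<theta>'\<close>. The derivative of \<open>C\<close> is linear, so
  inserting this decomposition of \<open>\<theta>'\<close> gives the second equation; eliminating \<open>\<gamma>'\<close> gives the third.\<close>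

section \<open>Differentiation under the integral sign\<close>

text \<open>Dominated convergence is applied to the remainder of the first-order expansion of
  \<open>f\<close> at \<open>q\<close>, divided by \<open>norm (p - q)\<close>. The bounds in
  \<open>dom\<close> come one direction at a time; adding those for the basis directions bounds the
  full derivative near \<open>q\<close>, and the mean value inequality then bounds the remainder by
  an integrable function.\<close>

lemma has_derivative_integral_locally_dominated:
  fixes f :: "'q::euclidean_space \<Rightarrow> 'z \<Rightarrow> real"
  assumes "open D" "q \<in> D"
    and int: "\<And>q. q \<in> D \<Longrightarrow> integrable \<mu> (f q)"
    and diff: "\<And>q z. q \<in> D \<Longrightarrow> z \<in> space \<mu> \<Longrightarrow> (\<lambda>q. f q z) differentiable (at q)"
    and dom: "\<And>u. locally_dominated \<mu> D (dir_deriv u f)"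
  shows integrable_dir_deriv: "\<And>u. integrable \<mu> (dir_deriv u f q)"
    and "((\<lambda>q. \<integral>z. f q z \<partial>\<mu>) has_derivative (\<lambda>u. \<integral>z. dir_deriv u f q z \<partial>\<mu>)) (at q)"
proof -
  have deriv: "((\<lambda>q. f q z) has_derivative (\<lambda>u. dir_deriv u f p z)) (at p)"
    if "p \<in> D" "z \<in> space \<mu>" for p z
    using diff[OF that] unfolding dir_deriv_def by (simp add: frechet_derivative_works)
  have lin: "bounded_linear (\<lambda>u. dir_deriv u f p z)" if "p \<in> D" "z \<in> space \<mu>" for p z
    using deriv[OF that] by (rule has_derivative_bounded_linear)
  \<comment> \<open>\<open>locally_dominated\<close> gives a bound but no measurability. The
    derivative is measurable as the pointwise limit of difference quotients with steps
    \<open>1 / Suc n\<close>, which never vanish; the shift by \<open>N\<close> keeps the displaced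
    points in \<open>D\<close>.\<close>
  have meas: "dir_deriv u f q \<in> borel_measurable \<mu>" for u
  proof -
    define s where "s n = (1 / real (Suc n))" for n
    have s: "filterlim s (at 0) sequentially"
      unfolding s_def using LIMSEQ_Suc[OF lim_1_over_n]
      by (auto simp: filterlim_at)
    have to: "(\<lambda>n. q + s n *\<^sub>R u) \<longlonglongrightarrow> q + 0 *\<^sub>R u"
      using s by (intro tendsto_intros) (auto simp: filterlim_at)
    then have "\<forall>\<^sub>F n in sequentially. q + s n *\<^sub>R u \<in> D"
      using topological_tendstoD[OF to \<open>open D\<close>] \<open>q \<in> D\<close> by auto
    then obtain N where N: "\<And>n. n \<ge> N \<Longrightarrow> q + s n *\<^sub>R u \<in> D"
      by (auto simp: eventually_sequentially)
    show ?thesis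
    proof (rule borel_measurable_LIMSEQ_metric)
      show "(\<lambda>z. (f (q + s (n + N) *\<^sub>R u) z - f q z) / s (n + N)) \<in> borel_measurable \<mu>" for n
        using int[of "q + s (n + N) *\<^sub>R u"] int[of q] N[of "n+N"] \<open>q \<in> D\<close>
        by (auto dest!: borel_measurable_integrable)
      fix z assume z: "z \<in> space \<mu>"
      have "((\<lambda>x. f (q + x *\<^sub>R u) z) has_derivative (\<lambda>x. dir_deriv (x *\<^sub>R u) f q z)) (at 0)"
        using deriv[OF \<open>q \<in> D\<close> z]
        by (intro has_derivative_compose[of "\<lambda>x. q + x *\<^sub>R u" "\<lambda>x. x *\<^sub>R u" 0 UNIV
              "\<lambda>q. f q z", simplified]) (auto intro!: derivative_eq_intros)
      then have "((\<lambda>x. f (q + x *\<^sub>R u) z) has_field_derivative dir_deriv u f q z) (at 0)"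
        by (simp add: has_field_derivative_def linear_cmul[OF bounded_linear.linear[OF lin[OF \<open>q \<in> D\<close> z]]]
            mult.commute[of "dir_deriv u f q z"] mult_commute_abs)
      then have "((\<lambda>x. (f (q + x *\<^sub>R u) z - f q z) / x) \<longlongrightarrow> dir_deriv u f q z) (at 0)"
        by (simp add: has_field_derivative_iff)
      from filterlim_compose[OF this s]
      show "(\<lambda>n. (f (q + s (n + N) *\<^sub>R u) z - f q z) / s (n + N)) \<longlonglongrightarrow> dir_deriv u f q z"
        by (rule LIMSEQ_ignore_initial_segment)
    qed
  qed
  have "\<forall>u. \<exists>p. fst p > 0 \<and> integrable \<mu> (snd p) \<and>
      (AE z in \<mu>. \<forall>q'\<in>D \<inter> ball q (fst p). \<bar>dir_deriv u f q' z\<bar> \<le> snd p z)"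
    using dom \<open>q \<in> D\<close> unfolding locally_dominated_def by simp
  from choice[OF this] obtain p where p: "\<And>u. fst (p u) > 0 \<and> integrable \<mu> (snd (p u)) \<and>
      (AE z in \<mu>. \<forall>q'\<in>D \<inter> ball q (fst (p u)). \<bar>dir_deriv u f q' z\<bar> \<le> snd (p u) z)"
    by blast
  define e h where "e u = fst (p u)" and "h u = snd (p u)" for u
  have e: "e u > 0" and h: "integrable \<mu> (h u)"
    and bound: "AE z in \<mu>. \<forall>p\<in>D \<inter> ball q (e u). \<bar>dir_deriv u f p z\<bar> \<le> h u z" for u
    using p[of u] unfolding e_def h_def by auto
  show integ: "integrable \<mu> (dir_deriv u f q)" for u
  proof (rule Bochner_Integration.integrable_bound[OF h[of u] meas])
    show "AE z in \<mu>. norm (dir_deriv u f q z) \<le> norm (h u z)"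
      using bound[of u] by eventually_elim (use \<open>q \<in> D\<close> e[of u] in \<open>auto dest!: bspec[where x = q]\<close>)
  qed
  obtain r where "r > 0" and r: "ball q r \<subseteq> D"
    using \<open>open D\<close> \<open>q \<in> D\<close> open_contains_ball by blast
  \<comment> \<open>One radius for everything: below \<open>r\<close>, so that the ball lies in
    \<open>D\<close>, and below the domination radius of each basis direction.\<close>
  define d where "d = Min (insert r (e ` Basis))"
  have d: "d > 0" "d \<le> r" "\<And>b. b \<in> Basis \<Longrightarrow> d \<le> e b"
    unfolding d_def using e \<open>r > 0\<close> by (auto intro!: min.coboundedI2 Min_le)
  \<comment> \<open>On \<open>ball q d\<close> this sum bounds the operator norm of the derivative,
    which is at most the sum of its norms on the basis vectors.\<close>
  define g where "g z = (\<Sum>b\<in>Basis. h b z)" for z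
  have g: "integrable \<mu> g" unfolding g_def using h by auto
  have gb: "AE z in \<mu>. \<forall>p\<in>ball q d. \<forall>b\<in>Basis. \<bar>dir_deriv b f p z\<bar> \<le> h b z"
  proof -
    have "AE z in \<mu>. \<forall>b\<in>Basis. \<forall>p\<in>D \<inter> ball q (e b). \<bar>dir_deriv b f p z\<bar> \<le> h b z"
      by (rule AE_finite_allI[OF finite_Basis]) (rule bound)
    then show ?thesis
      by eventually_elim (use d r in \<open>force simp: subset_eq\<close>)
  qed
  \<comment> \<open>The first bound is the mean value inequality on the convex ball, the second the
    operator norm bound at \<open>q\<close>. Together they bound the normalised remainder by
    \<open>2 * g z\<close>.\<close>
  have lip: "AE z in \<mu>. (\<forall>p\<in>ball q d. \<bar>f p z - f q z\<bar> \<le> g z * norm (p - q)) \<and>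
      (\<forall>v. \<bar>dir_deriv v f q z\<bar> \<le> g z * norm v)"
    using gb AE_space
  proof eventually_elim
    case (elim z)
    have on: "onorm (\<lambda>u. dir_deriv u f p z) \<le> g z" if "p \<in> ball q d" for p
    proof -
      have "p \<in> D" using that d r by (auto simp: subset_eq)
      have "onorm (\<lambda>u. dir_deriv u f p z) \<le> (\<Sum>b\<in>Basis. norm (dir_deriv b f p z))"
        by (rule onorm_componentwise[OF lin[OF \<open>p \<in> D\<close> elim(2)]])
      also have "\<dots> \<le> g z" unfolding g_def using elim that by (intro sum_mono) auto
      finally show ?thesis .
    qed
    have "\<bar>f p z - f q z\<bar> \<le> g z * norm (p - q)" if p: "p \<in> ball q d" for p
    proof -
      have "((\<lambda>q. f q z) has_derivative (\<lambda>u. dir_deriv u f p z)) (at p within ball q d)"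
        if "p \<in> ball q d" for p
        using deriv[of p z] that d r elim by (auto intro: has_derivative_at_withinI simp: subset_eq)
      from differentiable_bound[OF convex_ball this on p, of q] show ?thesis
        using d by auto
    qed
    moreover have "\<bar>dir_deriv v f q z\<bar> \<le> g z * norm v" for v
    proof -
      have "\<bar>dir_deriv v f q z\<bar> \<le> onorm (\<lambda>u. dir_deriv u f q z) * norm v"
        using onorm[OF lin[OF \<open>q \<in> D\<close> elim(2)], of v] by simp
      also have "\<dots> \<le> g z * norm v" using on[of q] d by (intro mult_right_mono) auto
      finally show ?thesis .
    qed
    ultimately show ?case by blast
  qed
  show "((\<lambda>q. \<integral>z. f q z \<partial>\<mu>) has_derivative (\<lambda>u. \<integral>z. dir_deriv u f q z \<partial>\<mu>)) (at q)"
    unfolding has_derivative_at_within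
  proof (intro conjI)
    have "linear (\<lambda>u. \<integral>z. dir_deriv u f q z \<partial>\<mu>)"
    proof (rule linearI)
      fix a b :: 'q and c :: real
      have "(\<integral>z. dir_deriv (a + b) f q z \<partial>\<mu>) = (\<integral>z. dir_deriv a f q z + dir_deriv b f q z \<partial>\<mu>)"
        using linear_add[OF bounded_linear.linear[OF lin[OF \<open>q \<in> D\<close>]]]
        by (intro Bochner_Integration.integral_cong) auto
      then show "(\<integral>z. dir_deriv (a + b) f q z \<partial>\<mu>) =
          (\<integral>z. dir_deriv a f q z \<partial>\<mu>) + (\<integral>z. dir_deriv b f q z \<partial>\<mu>)"
        using integ by simp
      have "(\<integral>z. dir_deriv (c *\<^sub>R a) f q z \<partial>\<mu>) = (\<integral>z. c * dir_deriv a f q z \<partial>\<mu>)"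
        using linear_cmul[OF bounded_linear.linear[OF lin[OF \<open>q \<in> D\<close>]]]
        by (intro Bochner_Integration.integral_cong) auto
      then show "(\<integral>z. dir_deriv (c *\<^sub>R a) f q z \<partial>\<mu>) = c *\<^sub>R (\<integral>z. dir_deriv a f q z \<partial>\<mu>)"
        by simp
    qed
    then show "bounded_linear (\<lambda>u. \<integral>z. dir_deriv u f q z \<partial>\<mu>)"
      by (rule linear_conv_bounded_linear[THEN iffD1])
    \<comment> \<open>The normalised remainder tends to 0 for each \<open>z\<close> by
      differentiability. Its integral is treated along sequences that converge to \<open>q\<close>
      and avoid it, because dominated convergence is sequential.\<close>
    define R where "R p z = (f p z - f q z - dir_deriv (p - q) f q z) /\<^sub>R norm (p - q)" for p z
    have "((\<lambda>p. \<integral>z. R p z \<partial>\<mu>) \<longlongrightarrow> (\<integral>z. 0 \<partial>\<mu>)) (at q)"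
      unfolding tendsto_at_iff_sequentially
    proof (intro allI impI)
      fix X :: "nat \<Rightarrow> 'q" assume X: "\<forall>i. X i \<in> UNIV - {q}" "X \<longlonglongrightarrow> q"
      then have "\<forall>\<^sub>F i in sequentially. X i \<in> ball q d"
        using d by (intro topological_tendstoD) auto
      then obtain N where N: "\<And>n. n \<ge> N \<Longrightarrow> X n \<in> ball q d"
        by (auto simp: eventually_sequentially)
      have "(\<lambda>n. \<integral>z. R (X (n + N)) z \<partial>\<mu>) \<longlonglongrightarrow> (\<integral>z. 0 \<partial>\<mu>)"
      proof (rule integral_dominated_convergence[where w = "\<lambda>z. 2 * g z"])
        show "R (X (n + N)) \<in> borel_measurable \<mu>" for n
          unfolding R_def using int[of "X (n + N)"] int[of q] N[of "n + N"] \<open>q \<in> D\<close> meas r d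
          by (auto dest!: borel_measurable_integrable simp: subset_eq)
        show "AE z in \<mu>. (\<lambda>n. R (X (n + N)) z) \<longlonglongrightarrow> 0"
        proof (rule AE_I2)
          fix z assume z: "z \<in> space \<mu>"
          have "((\<lambda>p. R p z) \<longlongrightarrow> 0) (at q)"
            using deriv[OF \<open>q \<in> D\<close> z] by (simp add: has_derivative_def R_def)
          then have "(\<lambda>n. R (X n) z) \<longlonglongrightarrow> 0"
            using X unfolding tendsto_at_iff_sequentially by (auto simp: o_def)
          then show "(\<lambda>n. R (X (n + N)) z) \<longlonglongrightarrow> 0" by (rule LIMSEQ_ignore_initial_segment)
        qed
        show "AE z in \<mu>. norm (R (X (n + N)) z) \<le> 2 * g z" for n
          using lip
        proof eventually_elim
          case (elim z)
          let ?v = "X (n + N) - q"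
          have "\<bar>f (X (n + N)) z - f q z - dir_deriv ?v f q z\<bar> \<le> g z * norm ?v + g z * norm ?v"
            using elim[THEN conjunct1, rule_format, OF N[of "n + N"]] elim[THEN conjunct2, rule_format, of ?v]
            by linarith
          moreover have "norm ?v > 0" using X(1) by auto
          ultimately show ?case by (simp add: R_def field_simps abs_mult)
        qed
      qed (use g in auto)
      then show "((\<lambda>p. \<integral>z. R p z \<partial>\<mu>) \<circ> X) \<longlonglongrightarrow> (\<integral>z. 0 \<partial>\<mu>)"
        unfolding o_def by (rule LIMSEQ_offset)
    qed
    \<comment> \<open>Splitting the integral of \<open>R\<close> requires \<open>f p\<close> to be
      integrable, which is known for \<open>p\<close> in \<open>D\<close>; so the identity is stated
      near \<open>q\<close>.\<close>
    moreover have "\<forall>\<^sub>F p in at q. (\<integral>z. R p z \<partial>\<mu>) =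
        ((\<integral>z. f p z \<partial>\<mu>) - (\<integral>z. f q z \<partial>\<mu>) - (\<integral>z. dir_deriv (p - q) f q z \<partial>\<mu>)) /\<^sub>R norm (p - q)"
      unfolding eventually_at using d \<open>r > 0\<close>
    proof (intro exI[of _ r] conjI ballI impI)
      fix p assume "p \<noteq> q \<and> dist p q < r"
      then have "p \<in> D" using r by (auto simp: dist_commute)
      then show "(\<integral>z. R p z \<partial>\<mu>) =
        ((\<integral>z. f p z \<partial>\<mu>) - (\<integral>z. f q z \<partial>\<mu>) - (\<integral>z. dir_deriv (p - q) f q z \<partial>\<mu>)) /\<^sub>R norm (p - q)"
        unfolding R_def using int integ \<open>q \<in> D\<close> by simp
    qed auto
    ultimately show "((\<lambda>p. ((\<integral>z. f p z \<partial>\<mu>) - (\<integral>z. f q z \<partial>\<mu>) -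
        (\<integral>z. dir_deriv (p - q) f q z \<partial>\<mu>)) /\<^sub>R norm (p - q)) \<longlongrightarrow> 0) (at q)"
      by (simp add: tendsto_cong)
  qed
qed

section \<open>Vector integrals, gradients and smooth functions\<close>

text \<open>A vector is the finite sum of its basis components. This carries the scalar
  integrability results over to the vector-valued \<open>H_grad\<close>.\<close>

lemma integrable_componentwise:
  fixes f :: "'z \<Rightarrow> 'b::euclidean_space"
  assumes "\<And>b. b \<in> Basis \<Longrightarrow> integrable \<mu> (\<lambda>z. b \<bullet> f z)"
  shows "integrable \<mu> f"
proof -
  have "integrable \<mu> (\<lambda>z. \<Sum>b\<in>Basis. (b \<bullet> f z) *\<^sub>R b)"
    using assms by (intro Bochner_Integration.integrable_sum integrable_scaleR_left) auto
  then show ?thesis by (simp add: inner_commute[of _ "f _"] euclidean_representation)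
qed

text \<open>Linearity of the derivative and the expansion of \<open>v\<close> in coordinate vectors.
  Gradients are handled below through their inner products with arbitrary directions.\<close>

lemma inner_gradient:
  assumes "f differentiable (at x)"
  shows "v \<bullet> gradient f x = frechet_derivative f (at x) v"
proof -
  have lin: "linear (frechet_derivative f (at x))"
    using assms by (rule linear_frechet_derivative)
  have "frechet_derivative f (at x) v = frechet_derivative f (at x) (\<Sum>i\<in>UNIV. (v $ i) *\<^sub>R axis i 1)"
    using basis_expansion[of v] by (simp add: scalar_mult_eq_scaleR)
  also have "\<dots> = v \<bullet> gradient f x"
    by (simp add: linear_sum[OF lin] linear_cmul[OF lin] gradient_def inner_vec_def)
  finally show ?thesis by simp
qed

lemma gradient_eqI:
  assumes "(f has_derivative (\<lambda>v. v \<bullet> g)) (at x)"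
  shows "gradient f x = g"
  using frechet_derivative_at[OF assms, symmetric] by (simp add: gradient_def inner_axis' vec_eq_iff)

text \<open>Level 2 of \<open>Ck_on\<close> speaks of derivatives within \<open>U\<close>. At every
  point of the open set \<open>U\<close> these agree with the unrestricted ones, so the derivative
  map may be replaced near \<open>x\<close> before it is differentiated again.\<close>

lemma smooth_on_open_differentiable:
  assumes "open U" "smooth_on U f" "x \<in> U"
  shows "f differentiable (at x)"
    and "(\<lambda>y. frechet_derivative f (at y) v) differentiable (at x)"
proof -
  have "Ck_on 2 U f" using assms by (simp add: smooth_on_def)
  then have 1: "f differentiable_on U"
    and 2: "(\<lambda>a. frechet_derivative f (at a within U) v) differentiable_on U"
    by (auto simp: numeral_2_eq_2)
  note at = at_within_open[OF \<open>x \<in> U\<close> \<open>open U\<close>]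
  show "f differentiable (at x)"
    using 1 \<open>x \<in> U\<close> unfolding differentiable_on_def at[symmetric] by blast
  have "(\<lambda>a. frechet_derivative f (at a within U) v) differentiable (at x)"
    using 2 \<open>x \<in> U\<close> unfolding differentiable_on_def by (metis at)
  then obtain F where F: "((\<lambda>a. frechet_derivative f (at a within U) v) has_derivative F) (at x)"
    by (auto simp: differentiable_def)
  have "((\<lambda>y. frechet_derivative f (at y) v) has_derivative F) (at x)"
    by (rule has_derivative_transform_within_open[OF F \<open>open U\<close> \<open>x \<in> U\<close>])
      (simp add: at_within_open[OF _ \<open>open U\<close>])
  then show "(\<lambda>y. frechet_derivative f (at y) v) differentiable (at x)"
    by (rule differentiableI)
qed

text \<open>The derivative of the logarithm is the quotient of the derivative of \<open>f\<close> by
  \<open>f\<close> throughout \<open>U\<close>, and that quotient is differentiable because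
  numerator and denominator are.\<close>

lemma smooth_on_open_ln_differentiable:
  fixes f :: "'a::real_normed_vector \<Rightarrow> real"
  assumes "open U" "smooth_on U f" "\<And>y. y \<in> U \<Longrightarrow> f y > 0" "x \<in> U"
  shows "(\<lambda>y. ln (f y)) differentiable (at x)"
    and "(\<lambda>y. frechet_derivative (\<lambda>y. ln (f y)) (at y) v) differentiable (at x)"
proof -
  have der: "((\<lambda>y. ln (f y)) has_derivative (\<lambda>v. frechet_derivative f (at y) v / f y)) (at y)"
    if "y \<in> U" for y
    using smooth_on_open_differentiable(1)[OF assms(1,2) that] assms(3)[OF that]
    by (auto intro!: derivative_eq_intros simp: frechet_derivative_works divide_inverse)
  show "(\<lambda>y. ln (f y)) differentiable (at x)"
    using der[OF \<open>x \<in> U\<close>] by (auto simp: differentiable_def)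
  have "(\<lambda>y. frechet_derivative f (at y) v / f y) differentiable (at x)"
    using smooth_on_open_differentiable[OF assms(1,2,4)] assms(3)[OF \<open>x \<in> U\<close>]
    by (intro differentiable_divide) auto
  then obtain F where "((\<lambda>y. frechet_derivative f (at y) v / f y) has_derivative F) (at x)"
    by (auto simp: differentiable_def)
  then have "((\<lambda>y. frechet_derivative (\<lambda>y. ln (f y)) (at y) v) has_derivative F) (at x)"
    by (rule has_derivative_transform_within_open[OF _ \<open>open U\<close> \<open>x \<in> U\<close>])
      (simp add: frechet_derivative_at[OF der, symmetric])
  then show "(\<lambda>y. frechet_derivative (\<lambda>y. ln (f y)) (at y) v) differentiable (at x)"
    by (auto simp: differentiable_def)
qed

section \<open>The Boltzmann weight of a single datum\<close>

text \<open>One datum is fixed, and the parameters range over the open set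
  \<open>U \<times> \<Lambda>\<close>. The assumption \<open>nonempty\<close> provides a parameter
  at which the prior is normalised, which excludes a null latent measure.\<close>

locale regular_model =
  fixes M :: "('n::finite, 'x, 'y::finite, 'z) model"
    and \<Theta> U :: "(real^'n) set" and \<Lambda> :: "(real \<times> real) set" and x :: 'x
  assumes model: "model_on \<Theta> U M"
    and nonempty: "\<Theta> \<noteq> {}"
    and open_\<Lambda>: "open \<Lambda>"
    and x_space: "x \<in> space (input_measure M)"
    and Z_finite: "\<And>\<theta> l g. \<theta> \<in> U \<Longrightarrow> (l, g) \<in> \<Lambda> \<Longrightarrow>
      integrable (latent_measure M) (\<lambda>z. exp (- hamiltonian M x \<theta> l g z))"
    and regular: "regular_integrals (U \<times> \<Lambda>) M x"
begin

abbreviation "\<mu> \<equiv> latent_measure M"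

lemma open_U: "open U"
  using model by (simp add: model_on_def)

lemma open_domain: "open (U \<times> \<Lambda>)"
  using open_U open_\<Lambda> by (rule open_Times)

lemma ln_model_differentiable:
  assumes "z \<in> space \<mu>" "\<theta> \<in> U"
  shows "(\<lambda>\<theta>. ln (prior M \<theta> z)) differentiable (at \<theta>)"
    and "(\<lambda>\<theta>. ln (decoder M \<theta> z x)) differentiable (at \<theta>)"
    and "(\<lambda>\<theta>. loglik M x \<theta> z) differentiable (at \<theta>)"
    and "(\<lambda>\<theta>. frechet_derivative (\<lambda>\<theta>. ln (prior M \<theta> z)) (at \<theta>) v) differentiable (at \<theta>)"
    and "(\<lambda>\<theta>. frechet_derivative (\<lambda>\<theta>. ln (decoder M \<theta> z x)) (at \<theta>) v) differentiable (at \<theta>)"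
    and "(\<lambda>\<theta>. frechet_derivative (\<lambda>\<theta>. loglik M x \<theta> z) (at \<theta>) v) differentiable (at \<theta>)"
  using model x_space assms unfolding model_on_def loglik_def
  by (auto intro!: smooth_on_open_ln_differentiable[of U])

lemma H_lam_eq: "H_lam M x \<theta> l g z = - ln (decoder M \<theta> z x)"
  unfolding H_lam_def hamiltonian_def
  by (rule DERIV_imp_deriv) (auto intro!: derivative_eq_intros)

lemma H_gam_eq: "H_gam M x \<theta> l g z = - loglik M x \<theta> z"
  unfolding H_gam_def hamiltonian_def loglik_def
  by (rule DERIV_imp_deriv) (auto intro!: derivative_eq_intros)

lemma hamiltonian_eq: "hamiltonian M x \<theta> l g z =
    - ln (prior M \<theta> z) - l * ln (decoder M \<theta> z x) - g * loglik M x \<theta> z"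
  by (simp add: hamiltonian_def loglik_def)

text \<open>For fixed \<open>l\<close> and \<open>g\<close> the Hamiltonian is a linear combination
  of three logarithms. Their derivatives are themselves differentiable in \<open>\<theta>\<close>,
  so this form can be differentiated once more.\<close>

lemma inner_H_grad:
  assumes "z \<in> space \<mu>" "\<theta> \<in> U"
  shows "v \<bullet> H_grad M x \<theta> l g z = - frechet_derivative (\<lambda>\<theta>. ln (prior M \<theta> z)) (at \<theta>) v
    - l * frechet_derivative (\<lambda>\<theta>. ln (decoder M \<theta> z x)) (at \<theta>) v
    - g * frechet_derivative (\<lambda>\<theta>. loglik M x \<theta> z) (at \<theta>) v" (is "_ = ?F v")
proof -
  have "((\<lambda>\<theta>. hamiltonian M x \<theta> l g z) has_derivative ?F) (at \<theta>)"
    unfolding hamiltonian_eq using ln_model_differentiable(1-3)[OF assms]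
    unfolding frechet_derivative_works
    by (intro has_derivative_diff has_derivative_minus has_derivative_mult_right)
  then show ?thesis
    unfolding H_grad_def
    by (subst inner_gradient) (auto simp: differentiable_def dest: frechet_derivative_at[symmetric])
qed

lemma inner_loglik_grad:
  assumes "z \<in> space \<mu>" "\<theta> \<in> U"
  shows "v \<bullet> loglik_grad M x \<theta> z = frechet_derivative (\<lambda>\<theta>. loglik M x \<theta> z) (at \<theta>) v"
  unfolding loglik_grad_def using ln_model_differentiable(3)[OF assms] by (rule inner_gradient)

lemma has_derivative_loglik:
  assumes "z \<in> space \<mu>" "\<theta> \<in> U"
  shows "((\<lambda>q. loglik M x (fst q) z) has_derivative
    (\<lambda>u. fst u \<bullet> loglik_grad M x \<theta> z)) (at (\<theta>, l, g))"
proof -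
  have "((\<lambda>\<theta>. loglik M x \<theta> z) has_derivative (\<lambda>v. v \<bullet> loglik_grad M x \<theta> z)) (at (fst (\<theta>, l, g)))"
    using ln_model_differentiable(3)[OF assms] inner_loglik_grad[OF assms]
    by (simp add: frechet_derivative_works)
  from has_derivative_compose[OF has_derivative_fst[OF has_derivative_ident] this]
  show ?thesis by simp
qed

text \<open>The terms with \<open>l\<close> and \<open>g\<close> are products of a coordinate and a
  function of \<open>\<theta>\<close>. The product rule yields both their share of the gradient and
  the \<open>H_lam\<close> and \<open>H_gam\<close> terms; the chain rule for \<open>exp\<close>
  does the rest.\<close>

lemma has_derivative_weight:
  assumes "z \<in> space \<mu>" "\<theta> \<in> U"
  shows "((\<lambda>q. weight M x q z) has_derivative
    (\<lambda>u. - exp (- hamiltonian M x \<theta> l g z) * (fst u \<bullet> H_grad M x \<theta> l g z +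
      fst (snd u) * H_lam M x \<theta> l g z + snd (snd u) * H_gam M x \<theta> l g z))) (at (\<theta>, l, g))"
proof -
  have fst: "((\<lambda>q. f (fst q)) has_derivative (\<lambda>u. frechet_derivative f (at \<theta>) (fst u)))
      (at (\<theta>, l, g))" if "f differentiable (at \<theta>)" for f :: "real^'n \<Rightarrow> real"
  proof -
    have "(f has_derivative frechet_derivative f (at \<theta>)) (at (fst (\<theta>, l, g)))"
      using that by (simp add: frechet_derivative_works)
    from has_derivative_compose[OF has_derivative_fst[OF has_derivative_ident] this]
    show ?thesis by simp
  qed
  have fst_snd: "((\<lambda>q. fst (snd q)) has_derivative (\<lambda>u. fst (snd u))) (at (\<theta>, l, g))"
    and snd_snd: "((\<lambda>q. snd (snd q)) has_derivative (\<lambda>u. snd (snd u))) (at (\<theta>, l, g))"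
    by (intro has_derivative_fst has_derivative_snd has_derivative_ident)+
  note log = ln_model_differentiable(1-3)[OF assms, THEN fst]
  have "((\<lambda>q. - hamiltonian M x (fst q) (fst (snd q)) (snd (snd q)) z) has_derivative
      (\<lambda>u. - (fst u \<bullet> H_grad M x \<theta> l g z +
        fst (snd u) * H_lam M x \<theta> l g z + snd (snd u) * H_gam M x \<theta> l g z))) (at (\<theta>, l, g))"
    unfolding hamiltonian_eq inner_H_grad[OF assms] H_lam_eq H_gam_eq
    by (rule has_derivative_eq_rhs[OF has_derivative_minus[OF has_derivative_diff[OF has_derivative_diff[OF
            has_derivative_minus[OF log(1)] has_derivative_mult[OF fst_snd log(2)]]
            has_derivative_mult[OF snd_snd log(3)]]]])
      (simp add: fun_eq_iff algebra_simps)
  from has_derivative_exp[OF this] show ?thesis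
    unfolding weight_def split_beta by (rule has_derivative_eq_rhs) (simp add: fun_eq_iff algebra_simps)
qed

lemma dir_deriv_weight:
  assumes "z \<in> space \<mu>" "\<theta> \<in> U"
  shows "dir_deriv (v, a, b) (weight M x) (\<theta>, l, g) z =
    - exp (- hamiltonian M x \<theta> l g z) * (v \<bullet> H_grad M x \<theta> l g z +
      a * H_lam M x \<theta> l g z + b * H_gam M x \<theta> l g z)"
  using frechet_derivative_at[OF has_derivative_weight[OF assms, of l g], symmetric]
  by (simp add: dir_deriv_def)

text \<open>The explicit first derivative is a product of the weight with logarithms, their
  \<open>\<theta>\<close>-derivatives and coordinates, each of which is differentiable.\<close>

lemma differentiable_dir_deriv_weight:
  assumes "z \<in> space \<mu>" "\<theta> \<in> U"
  shows "(\<lambda>q. dir_deriv u (weight M x) q z) differentiable (at (\<theta>, l, g))"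
proof -
  obtain v a b where u: "u = (v, a, b)" by (cases u)
  have comp: "(\<lambda>q. f (fst q)) differentiable (at (\<theta>, l, g))"
    if "f differentiable (at \<theta>)" for f :: "real^'n \<Rightarrow> real"
  proof -
    have "f differentiable (at (fst (\<theta>, l, g)))" using that by simp
    from differentiable_chain_at[OF bounded_linear_imp_differentiable[OF bounded_linear_fst] this]
    show ?thesis by (simp add: o_def)
  qed
  have fst_snd: "(\<lambda>q. fst (snd q)) differentiable (at (\<theta>, l, g))"
    and snd_snd: "(\<lambda>q. snd (snd q)) differentiable (at (\<theta>, l, g))"
    by (intro differentiableI[OF has_derivative_fst[OF has_derivative_snd[OF has_derivative_ident]]]
        differentiableI[OF has_derivative_snd[OF has_derivative_snd[OF has_derivative_ident]]])+
  have "(\<lambda>q. - weight M x q z * (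
      - frechet_derivative (\<lambda>\<theta>. ln (prior M \<theta> z)) (at (fst q)) v
      - fst (snd q) * frechet_derivative (\<lambda>\<theta>. ln (decoder M \<theta> z x)) (at (fst q)) v
      - snd (snd q) * frechet_derivative (\<lambda>\<theta>. loglik M x \<theta> z) (at (fst q)) v
      - a * ln (decoder M (fst q) z x) - b * loglik M x (fst q) z)) differentiable (at (\<theta>, l, g))"
    (is "?f differentiable _")
    by (intro differentiable_mult differentiable_diff differentiable_minus differentiable_const
        differentiableI[OF has_derivative_weight[OF assms]] fst_snd snd_snd
        ln_model_differentiable[OF assms, THEN comp])
  then obtain F where F: "(?f has_derivative F) (at (\<theta>, l, g))"
    by (auto simp: differentiable_def)
  \<comment> \<open>The explicit formula holds for all \<open>\<theta>\<close> in \<open>U\<close>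
    and all real \<open>l\<close>, \<open>g\<close>, hence on the open set
    \<open>U \<times> UNIV\<close>, so both functions have the same derivative.\<close>
  have "((\<lambda>q. dir_deriv u (weight M x) q z) has_derivative F) (at (\<theta>, l, g))"
  proof (rule has_derivative_transform_within_open[OF F, of "U \<times> UNIV"])
    show "open (U \<times> (UNIV :: (real \<times> real) set))" using open_U by (intro open_Times) auto
    show "?f q = dir_deriv u (weight M x) q z" if "q \<in> U \<times> UNIV" for q
      using that assms(1)
      by (cases q) (auto simp: u dir_deriv_weight inner_H_grad H_lam_eq H_gam_eq weight_def)
  qed (use assms in auto)
  then show ?thesis by (auto simp: differentiable_def)
qed

text \<open>The inner derivative is taken in the \<open>g\<close> direction and equals the weight
  times \<open>loglik\<close>. The product rule gives one term from the gradient of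
  \<open>loglik\<close> and one from the derivative of the weight.\<close>

lemma dir_deriv_loglik_weight:
  assumes "z \<in> space \<mu>" "\<theta> \<in> U"
  shows "dir_deriv (v, a, b) (dir_deriv (0, 0, 1) (weight M x)) (\<theta>, l, g) z =
    exp (- hamiltonian M x \<theta> l g z) * (v \<bullet> loglik_grad M x \<theta> z - loglik M x \<theta> z *
      (v \<bullet> H_grad M x \<theta> l g z + a * H_lam M x \<theta> l g z + b * H_gam M x \<theta> l g z))"
proof -
  let ?rhs = "\<lambda>u. exp (- hamiltonian M x \<theta> l g z) *
    (fst u \<bullet> loglik_grad M x \<theta> z - loglik M x \<theta> z * (fst u \<bullet> H_grad M x \<theta> l g z +
      fst (snd u) * H_lam M x \<theta> l g z + snd (snd u) * H_gam M x \<theta> l g z))"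
  have F: "((\<lambda>q. weight M x q z * loglik M x (fst q) z) has_derivative
      ?rhs) (at (\<theta>, l, g))"
    by (rule has_derivative_eq_rhs[OF has_derivative_mult[OF has_derivative_weight[OF assms]
            has_derivative_loglik[OF assms]]])
      (auto simp: fun_eq_iff weight_def algebra_simps)
  have "((\<lambda>q. dir_deriv (0, 0, 1) (weight M x) q z) has_derivative ?rhs) (at (\<theta>, l, g))"
  proof (rule has_derivative_transform_within_open[OF F, of "U \<times> UNIV"])
    show "open (U \<times> (UNIV :: (real \<times> real) set))" using open_U by (intro open_Times) auto
    show "weight M x q z * loglik M x (fst q) z = dir_deriv (0, 0, 1) (weight M x) q z"
      if "q \<in> U \<times> UNIV" for q
      using that assms(1) by (cases q) (auto simp: dir_deriv_weight H_gam_eq weight_def)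
  qed (use assms in auto)
  from frechet_derivative_at[OF this, symmetric] show ?thesis
    by (simp add: dir_deriv_def)
qed

lemma integrable_weight: "q \<in> U \<times> \<Lambda> \<Longrightarrow> integrable \<mu> (weight M x q)"
  by (cases q) (auto simp: weight_def[abs_def] Z_finite)

lemma locally_dominated_dir_deriv_weight:
  "locally_dominated \<mu> (U \<times> \<Lambda>) (dir_deriv u (weight M x))"
  "locally_dominated \<mu> (U \<times> \<Lambda>) (dir_deriv v (dir_deriv u (weight M x)))"
  using regular unfolding regular_integrals_def by blast+

lemma differentiable_weight:
  "q \<in> U \<times> \<Lambda> \<Longrightarrow> z \<in> space \<mu> \<Longrightarrow> (\<lambda>q. weight M x q z) differentiable (at q)"
  "q \<in> U \<times> \<Lambda> \<Longrightarrow> z \<in> space \<mu> \<Longrightarrow> (\<lambda>q. dir_deriv u (weight M x) q z) differentiable (at q)"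
  by (cases q, auto intro: differentiableI has_derivative_weight differentiable_dir_deriv_weight)+

lemma integrable_dir_deriv_weight:
    "q \<in> U \<times> \<Lambda> \<Longrightarrow> integrable \<mu> (dir_deriv u (weight M x) q)"
  and has_derivative_integral_weight: "q \<in> U \<times> \<Lambda> \<Longrightarrow>
    ((\<lambda>q. \<integral>z. weight M x q z \<partial>\<mu>) has_derivative
      (\<lambda>u. \<integral>z. dir_deriv u (weight M x) q z \<partial>\<mu>)) (at q)"
  by (rule has_derivative_integral_locally_dominated[OF open_domain];
      simp add: integrable_weight differentiable_weight locally_dominated_dir_deriv_weight)+

text \<open>A second application of differentiation under the integral, now to
  \<open>dir_deriv u (weight M x)\<close>: the first application supplies its integrability, and the
  second-order clause of \<open>regular_integrals\<close> the domination.\<close>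

lemma integrable_dir_deriv2_weight:
    "q \<in> U \<times> \<Lambda> \<Longrightarrow> integrable \<mu> (dir_deriv v (dir_deriv u (weight M x)) q)"
  and has_derivative_integral_dir_deriv_weight: "q \<in> U \<times> \<Lambda> \<Longrightarrow>
    ((\<lambda>q. \<integral>z. dir_deriv u (weight M x) q z \<partial>\<mu>) has_derivative
      (\<lambda>v. \<integral>z. dir_deriv v (dir_deriv u (weight M x)) q z \<partial>\<mu>)) (at q)"
  by (rule has_derivative_integral_locally_dominated[OF open_domain];
      simp add: integrable_dir_deriv_weight differentiable_weight locally_dominated_dir_deriv_weight)+

section \<open>Partition function and Gibbs averages of a single datum\<close>

lemma partition_fun_eq: "partition_fun M x \<theta> l g = (\<integral>z. weight M x (\<theta>, l, g) z \<partial>\<mu>)"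
  by (simp add: partition_fun_def weight_def)

text \<open>The integrand is positive everywhere, so a vanishing integral would make the latent
  measure null; then the prior would integrate to 0 instead of 1 at a parameter in
  \<open>\<Theta>\<close>.\<close>

lemma partition_fun_pos:
  assumes "\<theta> \<in> U" "(l, g) \<in> \<Lambda>"
  shows "partition_fun M x \<theta> l g > 0"
proof -
  have "partition_fun M x \<theta> l g \<noteq> 0"
  proof
    assume "partition_fun M x \<theta> l g = 0"
    then have "AE z in \<mu>. exp (- hamiltonian M x \<theta> l g z) = 0"
      using integral_nonneg_eq_0_iff_AE[OF Z_finite[OF assms]] by (simp add: partition_fun_def)
    then have "AE z in \<mu>. False" by simp
    moreover obtain \<phi> where "\<phi> \<in> \<Theta>" using nonempty by blast
    ultimately have "(\<integral>z. prior M \<phi> z \<partial>\<mu>) = 0"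
      by (intro integral_eq_zero_AE) auto
    then show False using model \<open>\<phi> \<in> \<Theta>\<close> by (auto simp: model_on_def)
  qed
  moreover have "partition_fun M x \<theta> l g \<ge> 0"
    unfolding partition_fun_def by (rule Bochner_Integration.integral_nonneg) simp
  ultimately show ?thesis by simp
qed

text \<open>By \<open>H_gam_eq\<close> the derivative of the weight in the \<open>g\<close>
  direction is \<open>loglik\<close> times the weight. The mean of \<open>loglik\<close> thus
  becomes a quotient of two integrals whose derivatives are known.\<close>

lemma gibbs_loglik_eq:
  assumes "\<theta> \<in> U" "(l, g) \<in> \<Lambda>"
  shows "gibbs M x \<theta> l g (loglik M x \<theta>) =
    (\<integral>z. dir_deriv (0, 0, 1) (weight M x) (\<theta>, l, g) z \<partial>\<mu>) / partition_fun M x \<theta> l g"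
proof -
  have "(\<integral>z. dir_deriv (0, 0, 1) (weight M x) (\<theta>, l, g) z \<partial>\<mu>) =
      (\<integral>z. exp (- hamiltonian M x \<theta> l g z) * loglik M x \<theta> z \<partial>\<mu>)"
    by (intro Bochner_Integration.integral_cong) (auto simp: dir_deriv_weight H_gam_eq assms)
  then show ?thesis by (simp add: gibbs_def divide_inverse)
qed

context
  fixes \<theta> :: "real^'n" and l g :: real
  assumes \<theta>: "\<theta> \<in> U" and lg: "(l, g) \<in> \<Lambda>"
begin

abbreviation "E z \<equiv> exp (- hamiltonian M x \<theta> l g z)"
abbreviation "Z \<equiv> partition_fun M x \<theta> l g"
abbreviation "avg \<equiv> (\<lambda>\<phi> :: 'z \<Rightarrow> real. gibbs M x \<theta> l g \<phi>)"
abbreviation "ll \<equiv> loglik M x \<theta>"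
abbreviation "gll \<equiv> loglik_grad M x \<theta>"
abbreviation "Hl \<equiv> H_lam M x \<theta> l g"
abbreviation "Hg \<equiv> H_gam M x \<theta> l g"
abbreviation "gH \<equiv> H_grad M x \<theta> l g"

lemma integral_eq_gibbs: "(\<integral>z. E z * \<phi> z \<partial>\<mu>) = Z * avg \<phi>"
  using partition_fun_pos[OF \<theta> lg] by (simp add: gibbs_def)

text \<open>The integrand is minus a first directional derivative of the weight. Special choices of
  \<open>v\<close>, \<open>a\<close>, \<open>b\<close> afterwards separate the three terms.\<close>

lemma integrable_weight_H:
  "integrable \<mu> (\<lambda>z. E z * (v \<bullet> gH z + a * Hl z + b * Hg z))"
proof -
  have "integrable \<mu> (\<lambda>z. - dir_deriv (v, a, b) (weight M x) (\<theta>, l, g) z)"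
    using integrable_dir_deriv_weight[of "(\<theta>, l, g)"] \<theta> lg by simp
  then show ?thesis
    by (rule Bochner_Integration.integrable_cong[THEN iffD1, rotated -1])
      (auto simp: dir_deriv_weight \<theta>)
qed

lemma integrable_weight_H_grad: "integrable \<mu> (\<lambda>z. E z * (v \<bullet> gH z))"
  and integrable_weight_H_lam: "integrable \<mu> (\<lambda>z. E z * Hl z)"
  and integrable_weight_H_gam: "integrable \<mu> (\<lambda>z. E z * Hg z)"
  using integrable_weight_H[of v 0 0] integrable_weight_H[of 0 1 0] integrable_weight_H[of 0 0 1]
  by simp_all

text \<open>The inner product with \<open>v\<close> passes through the Bochner integral once the
  vector integrand is integrable, and that is checked on components.\<close>

lemma inner_gibbs_H_grad: "v \<bullet> gibbs M x \<theta> l g gH = avg (\<lambda>z. v \<bullet> gH z)"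
proof -
  have "integrable \<mu> (\<lambda>z. E z *\<^sub>R gH z)"
    by (rule integrable_componentwise) (simp only: inner_scaleR_right integrable_weight_H_grad)
  then have "(\<integral>z. v \<bullet> (E z *\<^sub>R gH z) \<partial>\<mu>) = v \<bullet> (\<integral>z. E z *\<^sub>R gH z \<partial>\<mu>)"
    by (intro integral_inner_right)
  then show ?thesis
    by (simp add: gibbs_def)
qed

lemma integrable_weight_loglik_grad: "integrable \<mu> (\<lambda>z. E z * (v \<bullet> gll z))"
proof -
  have "integrable \<mu> (\<lambda>z. E z *\<^sub>R gll z)"
    using regular \<theta> lg by (auto simp: regular_integrals_def)
  then have "integrable \<mu> (\<lambda>z. v \<bullet> (E z *\<^sub>R gll z))" by (rule integrable_inner_right)
  then show ?thesis by simp
qed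

text \<open>The second-order bound controls only the difference between the \<open>gll\<close> term
  and this one. The \<open>gll\<close> term is integrable by the last clause of
  \<open>regular_integrals\<close>, so subtraction isolates this one.\<close>

lemma integrable_weight_loglik_H:
  "integrable \<mu> (\<lambda>z. E z * (ll z * (v \<bullet> gH z + a * Hl z + b * Hg z)))"
proof -
  have "integrable \<mu> (dir_deriv (v, a, b) (dir_deriv (0, 0, 1) (weight M x)) (\<theta>, l, g))"
    using integrable_dir_deriv2_weight[of "(\<theta>, l, g)"] \<theta> lg by simp
  then have "integrable \<mu> (\<lambda>z. E z * (v \<bullet> gll z) -
      dir_deriv (v, a, b) (dir_deriv (0, 0, 1) (weight M x)) (\<theta>, l, g) z)"
    using integrable_weight_loglik_grad by (intro Bochner_Integration.integrable_diff)
  then show ?thesis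
    by (rule Bochner_Integration.integrable_cong[THEN iffD1, rotated -1])
      (auto simp: dir_deriv_loglik_weight \<theta> algebra_simps)
qed

lemma integrable_weight_loglik_H_grad: "integrable \<mu> (\<lambda>z. E z * (ll z * (v \<bullet> gH z)))"
  and integrable_weight_loglik_H_lam: "integrable \<mu> (\<lambda>z. E z * (ll z * Hl z))"
  and integrable_weight_loglik_H_gam: "integrable \<mu> (\<lambda>z. E z * (ll z * Hg z))"
  using integrable_weight_loglik_H[of v 0 0] integrable_weight_loglik_H[of 0 1 0]
    integrable_weight_loglik_H[of 0 0 1]
  by simp_all

lemma integral_dir_deriv_weight: "(\<integral>z. dir_deriv (v, a, b) (weight M x) (\<theta>, l, g) z \<partial>\<mu>) =
  - Z * (avg (\<lambda>z. v \<bullet> gH z) + a * avg Hl + b * avg Hg)"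
proof -
  have "(\<integral>z. dir_deriv (v, a, b) (weight M x) (\<theta>, l, g) z \<partial>\<mu>) =
      (\<integral>z. - (E z * (v \<bullet> gH z) + a * (E z * Hl z) + b * (E z * Hg z)) \<partial>\<mu>)"
    by (intro Bochner_Integration.integral_cong) (auto simp: dir_deriv_weight \<theta> algebra_simps)
  also have "\<dots> = - (Z * avg (\<lambda>z. v \<bullet> gH z) + a * (Z * avg Hl) + b * (Z * avg Hg))"
    by (simp add: integrable_weight_H_grad integrable_weight_H_lam integrable_weight_H_gam
        integral_eq_gibbs)
  finally show ?thesis by (simp add: algebra_simps)
qed

text \<open>Each of the four terms of the second derivative is integrable by itself, so the integral
  splits into the separate averages that occur in the response coefficients.\<close>

lemma integral_dir_deriv_loglik_weight:
  "(\<integral>z. dir_deriv (v, a, b) (dir_deriv (0, 0, 1) (weight M x)) (\<theta>, l, g) z \<partial>\<mu>) =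
  Z * (avg (\<lambda>z. v \<bullet> gll z) - avg (\<lambda>z. ll z * (v \<bullet> gH z))
    - a * avg (\<lambda>z. Hl z * ll z) - b * avg (\<lambda>z. Hg z * ll z))"
proof -
  have "(\<integral>z. dir_deriv (v, a, b) (dir_deriv (0, 0, 1) (weight M x)) (\<theta>, l, g) z \<partial>\<mu>) =
      (\<integral>z. E z * (v \<bullet> gll z) - E z * (ll z * (v \<bullet> gH z))
        - a * (E z * (ll z * Hl z)) - b * (E z * (ll z * Hg z)) \<partial>\<mu>)"
    by (intro Bochner_Integration.integral_cong) (auto simp: dir_deriv_loglik_weight \<theta> algebra_simps)
  also have "\<dots> = Z * avg (\<lambda>z. v \<bullet> gll z) - Z * avg (\<lambda>z. ll z * (v \<bullet> gH z))
      - a * (Z * avg (\<lambda>z. ll z * Hl z)) - b * (Z * avg (\<lambda>z. ll z * Hg z))"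
    by (simp add: integrable_weight_loglik_grad integrable_weight_loglik_H_grad
        integrable_weight_loglik_H_lam integrable_weight_loglik_H_gam integral_eq_gibbs)
  finally show ?thesis by (simp add: algebra_simps)
qed

lemma has_derivative_partition_fun:
  "((\<lambda>q. partition_fun M x (fst q) (fst (snd q)) (snd (snd q))) has_derivative
    (\<lambda>u. - Z * (avg (\<lambda>z. fst u \<bullet> gH z) + fst (snd u) * avg Hl + snd (snd u) * avg Hg)))
    (at (\<theta>, l, g))"
proof -
  have "((\<lambda>q. \<integral>z. weight M x q z \<partial>\<mu>) has_derivative
      (\<lambda>u. \<integral>z. dir_deriv (fst u, fst (snd u), snd (snd u)) (weight M x) (\<theta>, l, g) z \<partial>\<mu>)) (at (\<theta>, l, g))"
    using has_derivative_integral_weight[of "(\<theta>, l, g)"] \<theta> lg by simp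
  then show ?thesis
    unfolding integral_dir_deriv_weight by (simp add: partition_fun_eq)
qed

lemma has_derivative_ln_partition_fun:
  "((\<lambda>\<theta>. ln (partition_fun M x \<theta> l g)) has_derivative
    (\<lambda>v. - (v \<bullet> gibbs M x \<theta> l g gH))) (at \<theta>)"
proof -
  have "((\<lambda>\<phi>. (\<phi>, l, g)) has_derivative (\<lambda>v. (v, 0, 0))) (at \<theta>)"
    by (intro has_derivative_Pair has_derivative_ident has_derivative_const)
  from has_derivative_compose[OF this has_derivative_partition_fun]
  have "((\<lambda>\<phi>. partition_fun M x \<phi> l g) has_derivative (\<lambda>v. - Z * avg (\<lambda>z. v \<bullet> gH z))) (at \<theta>)"
    by simp
  from has_derivative_ln[OF partition_fun_pos[OF \<theta> lg] this] show ?thesis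
    by (rule has_derivative_eq_rhs)
      (use partition_fun_pos[OF \<theta> lg] in \<open>simp add: fun_eq_iff inner_gibbs_H_grad\<close>)
qed

text \<open>Quotient rule. Products of two averages come from the derivative of the denominator
  \<open>Z\<close>; averages of products and the average of the \<open>loglik\<close> gradient come
  from the numerator.\<close>

lemma has_derivative_gibbs_loglik:
  "((\<lambda>q. gibbs M x (fst q) (fst (snd q)) (snd (snd q)) (loglik M x (fst q))) has_derivative
    (\<lambda>u. fst (snd u) * (avg Hl * avg ll - avg (\<lambda>z. Hl z * ll z))
      + snd (snd u) * (avg Hg * avg ll - avg (\<lambda>z. Hg z * ll z))
      + avg (\<lambda>z. fst u \<bullet> gH z) * avg ll - avg (\<lambda>z. ll z * (fst u \<bullet> gH z))
      + avg (\<lambda>z. fst u \<bullet> gll z))) (at (\<theta>, l, g))"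
proof -
  have Z: "Z \<noteq> 0" using partition_fun_pos[OF \<theta> lg] by simp
  have N: "(\<integral>z. dir_deriv (0, 0, 1) (weight M x) (\<theta>, l, g) z \<partial>\<mu>) = Z * avg ll"
    using gibbs_loglik_eq[OF \<theta> lg] Z by simp
  have "((\<lambda>q. \<integral>z. dir_deriv (0, 0, 1) (weight M x) q z \<partial>\<mu>) has_derivative
      (\<lambda>u. Z * (avg (\<lambda>z. fst u \<bullet> gll z) - avg (\<lambda>z. ll z * (fst u \<bullet> gH z))
    - fst (snd u) * avg (\<lambda>z. Hl z * ll z) - snd (snd u) * avg (\<lambda>z. Hg z * ll z)))) (at (\<theta>, l, g))"
    using has_derivative_integral_dir_deriv_weight[of "(\<theta>, l, g)"] \<theta> lg
    by (auto simp: integral_dir_deriv_loglik_weight[symmetric])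
  note quotient = has_derivative_divide'[OF this has_derivative_partition_fun, unfolded fst_conv snd_conv, OF Z]
  \<comment> \<open>Here \<open>Z * K\<close> is the derivative of the numerator,
    \<open>Z * A\<close> the numerator with \<open>A = avg ll\<close>, and \<open>- Z * L\<close>
    the derivative of \<open>Z\<close>.\<close>
  have quotient_eq: "(Z * K * Z - Z * A * (- Z * L)) / (Z * Z) = K + A * L" for K A L
    using Z by (simp add: field_simps)
  have "((\<lambda>q. (\<integral>z. dir_deriv (0, 0, 1) (weight M x) q z \<partial>\<mu>) /
      partition_fun M x (fst q) (fst (snd q)) (snd (snd q))) has_derivative
    (\<lambda>u. fst (snd u) * (avg Hl * avg ll - avg (\<lambda>z. Hl z * ll z))
      + snd (snd u) * (avg Hg * avg ll - avg (\<lambda>z. Hg z * ll z))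
      + avg (\<lambda>z. fst u \<bullet> gH z) * avg ll - avg (\<lambda>z. ll z * (fst u \<bullet> gH z))
      + avg (\<lambda>z. fst u \<bullet> gll z))) (at (\<theta>, l, g))"
    using quotient unfolding N quotient_eq
    by (rule has_derivative_eq_rhs) (simp add: fun_eq_iff algebra_simps)
  then show ?thesis
    by (rule has_derivative_transform_within_open[OF _ open_domain])
      (use \<theta> lg in \<open>auto simp: gibbs_loglik_eq\<close>)
qed

end

text \<open>Each component is minus the quotient of the integral of a first derivative of the weight
  by \<open>Z\<close>. Bare differentiability suffices, as second derivatives enter the coefficients
  only through the Hessian and mixed derivatives of \<open>J\<close>.\<close>

lemma differentiable_gibbs_H_grad:
  assumes \<theta>: "\<theta> \<in> U" and lg: "(l, g) \<in> \<Lambda>"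
  shows "(\<lambda>q. gibbs M x (fst q) (fst (snd q)) (snd (snd q))
      (H_grad M x (fst q) (fst (snd q)) (snd (snd q)))) differentiable (at (\<theta>, l, g))"
proof (rule iffD2[OF differentiable_componentwise_within], rule ballI)
  fix i :: "real^'n"
  have "(\<lambda>q. - ((\<integral>z. dir_deriv (i, 0, 0) (weight M x) q z \<partial>\<mu>) /
      partition_fun M x (fst q) (fst (snd q)) (snd (snd q)))) differentiable (at (\<theta>, l, g))"
    using partition_fun_pos[OF \<theta> lg] \<theta> lg
    by (intro differentiable_minus differentiable_divide
        differentiableI[OF has_derivative_integral_dir_deriv_weight]
        differentiableI[OF has_derivative_partition_fun]) auto
  then obtain F where "((\<lambda>q. - ((\<integral>z. dir_deriv (i, 0, 0) (weight M x) q z \<partial>\<mu>) /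
      partition_fun M x (fst q) (fst (snd q)) (snd (snd q)))) has_derivative F) (at (\<theta>, l, g))"
    by (auto simp: differentiable_def)
  then have "((\<lambda>q. gibbs M x (fst q) (fst (snd q)) (snd (snd q))
      (H_grad M x (fst q) (fst (snd q)) (snd (snd q))) \<bullet> i) has_derivative F) (at (\<theta>, l, g))"
  proof (rule has_derivative_transform_within_open[OF _ open_domain])
    fix q assume "q \<in> U \<times> \<Lambda>"
    then have q: "fst q \<in> U" "(fst (snd q), snd (snd q)) \<in> \<Lambda>" by auto
    from partition_fun_pos[OF q] show "- ((\<integral>z. dir_deriv (i, 0, 0) (weight M x) q z \<partial>\<mu>) /
        partition_fun M x (fst q) (fst (snd q)) (snd (snd q))) =
      gibbs M x (fst q) (fst (snd q)) (snd (snd q))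
        (H_grad M x (fst q) (fst (snd q)) (snd (snd q))) \<bullet> i"
      using integral_dir_deriv_weight[OF q, of i 0 0] inner_gibbs_H_grad[OF q, of i]
      by (simp add: inner_commute[of _ i])
  qed (use \<theta> lg in auto)
  then show "(\<lambda>q. gibbs M x (fst q) (fst (snd q)) (snd (snd q))
      (H_grad M x (fst q) (fst (snd q)) (snd (snd q))) \<bullet> i) differentiable (at (\<theta>, l, g))"
    by (rule differentiableI)
qed

end

section \<open>Matrix inverses, data averages and the chain rule along a path\<close>

lemma matrix_inv_mult_vec:
  fixes A :: "real^'n^'n"
  assumes "invertible A"
  shows "matrix_inv A *v (A *v w) = w"
proof -
  have "matrix_inv A ** A = mat 1"
    using someI_ex[OF assms[unfolded invertible_def]] by (simp add: matrix_inv_def)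
  then show ?thesis by (simp add: matrix_vector_mul_assoc)
qed

text \<open>With finite support the integral over counting measure is a finite sum, so the data
  averages below are differentiated term by term.\<close>

lemma data_integral_finite:
  assumes "finite S" "\<And>x. x \<notin> S \<Longrightarrow> w x = 0"
  shows "data_integral w f = (\<Sum>x\<in>S. w x *\<^sub>R f x)"
proof -
  have sub: "{x. w x *\<^sub>R f x \<noteq> 0} \<subseteq> S" using assms(2) by auto
  have "data_integral w f = (\<Sum>x | w x *\<^sub>R f x \<noteq> 0. w x *\<^sub>R f x)"
    unfolding data_integral_def
    using lebesgue_integral_count_space_finite_support[of UNIV "\<lambda>x. w x *\<^sub>R f x"]
      finite_subset[OF sub \<open>finite S\<close>] by simp
  also have "\<dots> = (\<Sum>x\<in>S. w x *\<^sub>R f x)"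
    using assms(1) sub by (intro sum.mono_neutral_left) auto
  finally show ?thesis .
qed

lemma data_velocity_eq: "data_velocity xs xt t x = pmf (empirical xt) x - pmf (empirical xs) x"
  unfolding data_velocity_def data_mass_def
  by (rule DERIV_imp_deriv) (auto intro!: derivative_eq_intros)

lemma pmf_empirical_eq_0: "xs \<noteq> [] \<Longrightarrow> x \<notin> set xs \<Longrightarrow> pmf (empirical xs) x = 0"
  by (simp add: empirical_def pmf_eq_0_set_pmf)

text \<open>Each mass is affine in time with slope \<open>data_velocity\<close>. The product rule
  separates the change of the integrand from the change of the distribution.\<close>

lemma has_derivative_data_mass_sum:
  fixes f :: "'x \<Rightarrow> 'q::real_normed_vector \<Rightarrow> 'b::real_normed_vector"
  assumes "\<And>x. x \<in> S \<Longrightarrow> (f x has_derivative f' x) (at q)"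
  shows "((\<lambda>p. \<Sum>x\<in>S. data_mass xs xt (snd p) x *\<^sub>R f x (fst p)) has_derivative
    (\<lambda>u. \<Sum>x\<in>S. data_mass xs xt t x *\<^sub>R f' x (fst u) + (snd u * data_velocity xs xt t x) *\<^sub>R f x q))
    (at (q, t))"
proof (rule has_derivative_sum)
  fix x assume "x \<in> S"
  then have "(f x has_derivative f' x) (at (fst (q, t)))" using assms by simp
  from has_derivative_compose[OF has_derivative_fst[OF has_derivative_ident] this]
  have f: "((\<lambda>p. f x (fst p)) has_derivative (\<lambda>u. f' x (fst u))) (at (q, t))" by simp
  have w: "((\<lambda>p. data_mass xs xt (snd p) x) has_derivative (\<lambda>u. snd u * data_velocity xs xt t x)) (at (q, t))"
  proof -
    have "((\<lambda>p. pmf (empirical xs) x + snd p * data_velocity xs xt t x) has_derivative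
        (\<lambda>u. 0 + snd u * data_velocity xs xt t x)) (at (q, t))"
      by (intro has_derivative_add has_derivative_const has_derivative_mult_left
          has_derivative_snd has_derivative_ident)
    then show ?thesis
      by (simp add: data_mass_def[abs_def] data_velocity_eq algebra_simps)
  qed
  from has_derivative_scaleR[OF w f]
  show "((\<lambda>p. data_mass xs xt (snd p) x *\<^sub>R f x (fst p)) has_derivative
    (\<lambda>u. data_mass xs xt t x *\<^sub>R f' x (fst u) + (snd u * data_velocity xs xt t x) *\<^sub>R f x q)) (at (q, t))"
    by simp
qed

text \<open>Chain rule in the closed interval, where derivatives at 0 and 1 are one-sided. The
  derivative of the composite equals the given derivative 0 of \<open>G\<close> by uniqueness within
  a nondegenerate interval. The final component 1 is the velocity of time itself.\<close>

lemma has_derivative_path_eq_0: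
  fixes F :: "((real^'n) \<times> real \<times> real) \<times> real \<Rightarrow> 'b::real_normed_vector"
  assumes F: "(F has_derivative F') (at ((\<theta> t, lam t, gam t), t))"
    and path: "\<theta> differentiable (at t within {0..1})" "lam differentiable (at t within {0..1})"
      "gam differentiable (at t within {0..1})"
    and eq: "\<And>s. s \<in> {0..1} \<Longrightarrow> G s = F ((\<theta> s, lam s, gam s), s)"
    and G: "(G has_vector_derivative 0) (at t within {0..1})"
    and t: "t \<in> {0..1}"
  shows "F' ((vector_derivative \<theta> (at t within {0..1}),
    vector_derivative lam (at t within {0..1}), vector_derivative gam (at t within {0..1})), 1) = 0"
    (is "F' ?v = 0")
proof -
  have "((\<lambda>s. ((\<theta> s, lam s, gam s), s)) has_derivative (\<lambda>h. h *\<^sub>R ?v)) (at t within {0..1})"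
    using path[unfolded vector_derivative_works has_vector_derivative_def]
    by (intro has_derivative_eq_rhs[OF has_derivative_Pair[OF has_derivative_Pair[OF _
          has_derivative_Pair] has_derivative_ident]]) auto
  from has_derivative_compose[OF this F]
  have "((\<lambda>s. F ((\<theta> s, lam s, gam s), s)) has_vector_derivative F' ?v) (at t within {0..1})"
    unfolding has_vector_derivative_def linear_cmul[OF has_derivative_linear[OF F]] .
  then have "(G has_vector_derivative F' ?v) (at t within {0..1})"
    by (rule has_vector_derivative_transform[OF t, rotated]) (rule eq)
  with G t show ?thesis
    using vector_derivative_unique_within_closed_interval[of 0 1 t G] by (auto simp: cbox_interval)
qed

lemma smooth_on_differentiable:
  "smooth_on S f \<Longrightarrow> x \<in> S \<Longrightarrow> f differentiable (at x within S)"
  by (auto simp: smooth_on_def differentiable_on_def dest: spec[of _ "Suc 0"])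

section \<open>Joint derivatives of the data-averaged gradient and loss\<close>

locale regular_data =
  fixes M :: "('n::finite, 'x, 'y::finite, 'z) model"
    and xs xt :: "'x list"
    and \<Theta> U :: "(real^'n) set" and \<Lambda> :: "(real \<times> real) set"
  assumes nonempty: "xs \<noteq> []" "xt \<noteq> []"
    and regular_model: "\<And>x. x \<in> set xs \<union> set xt \<Longrightarrow> regular_model M \<Theta> U \<Lambda> x"
    and open_U: "open U" and open_\<Lambda>: "open \<Lambda>"
begin

abbreviation "S \<equiv> set xs \<union> set xt"

text \<open>The parameters form one point of a product space, so that a joint derivative in all of
  them can be taken; likewise for \<open>mean_loglik\<close>.\<close>

definition mean_grad :: "'x \<Rightarrow> (real^'n) \<times> real \<times> real \<Rightarrow> real^'n" where
  "mean_grad x q = gibbs M x (fst q) (fst (snd q)) (snd (snd q))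
      (H_grad M x (fst q) (fst (snd q)) (snd (snd q)))"

definition mean_loglik :: "'x \<Rightarrow> (real^'n) \<times> real \<times> real \<Rightarrow> real" where
  "mean_loglik x q = gibbs M x (fst q) (fst (snd q)) (snd (snd q)) (loglik M x (fst q))"

lemma data_expectation_eq: "data_expectation xs xt t f = (\<Sum>x\<in>S. data_mass xs xt t x *\<^sub>R f x)"
  unfolding data_expectation_def
  by (intro data_integral_finite) (auto simp: data_mass_def pmf_empirical_eq_0 nonempty)

lemma data_integral_velocity_eq:
  "data_integral (data_velocity xs xt t) f = (\<Sum>x\<in>S. data_velocity xs xt t x *\<^sub>R f x)"
  by (intro data_integral_finite) (auto simp: data_velocity_eq pmf_empirical_eq_0 nonempty)

text \<open>At each datum the gradient of \<open>- ln Z\<close> is the Gibbs average of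
  \<open>H_grad\<close>, and \<open>J\<close> is the finite sum of these terms weighted by the
  masses.\<close>

lemma J_grad_eq:
  assumes "\<theta> \<in> U" "(l, g) \<in> \<Lambda>"
  shows "J_grad M xs xt \<theta> l g t = (\<Sum>x\<in>S. data_mass xs xt t x *\<^sub>R mean_grad x (\<theta>, l, g))"
  unfolding J_grad_def
proof (rule gradient_eqI)
  have "((\<lambda>\<theta>. - (\<Sum>x\<in>S. data_mass xs xt t x *\<^sub>R ln (partition_fun M x \<theta> l g))) has_derivative
      (\<lambda>v. - (\<Sum>x\<in>S. data_mass xs xt t x *\<^sub>R - (v \<bullet> mean_grad x (\<theta>, l, g))))) (at \<theta>)"
    unfolding mean_grad_def fst_conv snd_conv
    by (intro has_derivative_minus has_derivative_sum has_derivative_scaleR_right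
        regular_model.has_derivative_ln_partition_fun[OF regular_model] assms)
  then show "((\<lambda>\<theta>. J M xs xt \<theta> l g t) has_derivative
      (\<lambda>v. v \<bullet> (\<Sum>x\<in>S. data_mass xs xt t x *\<^sub>R mean_grad x (\<theta>, l, g)))) (at \<theta>)"
    unfolding J_def data_expectation_eq by (simp add: inner_sum_right sum_negf)
qed

text \<open>All ingredients of the three \<open>\<theta>\<close>-responses are values of a single
  derivative \<open>F'\<close>: varying one coordinate of \<open>((\<theta>, l, g), t)\<close> with
  the others frozen gives the Hessian, the two mixed derivatives and the time term.\<close>

lemma theta_response:
  assumes q: "\<theta> \<in> U" "(l, g) \<in> \<Lambda>"
  obtains F' where
    "((\<lambda>p. \<Sum>x\<in>S. data_mass xs xt (snd p) x *\<^sub>R mean_grad x (fst p)) has_derivative F')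
      (at ((\<theta>, l, g), t))"
    and "\<And>w. J_hess M xs xt \<theta> l g t *v w = F' ((w, 0, 0), 0)"
    and "vector_derivative (\<lambda>l'. J_grad M xs xt \<theta> l' g t) (at l) = F' ((0, 1, 0), 0)"
    and "vector_derivative (\<lambda>g'. J_grad M xs xt \<theta> l g' t) (at g) = F' ((0, 0, 1), 0)"
    and "data_integral (data_velocity xs xt t) (\<lambda>x. gibbs M x \<theta> l g (H_grad M x \<theta> l g)) = F' (0, 1)"
proof -
  let ?F = "\<lambda>p. \<Sum>x\<in>S. data_mass xs xt (snd p) x *\<^sub>R mean_grad x (fst p)"
  have "\<exists>D. (mean_grad x has_derivative D) (at (\<theta>, l, g))" if "x \<in> S" for x
    using regular_model.differentiable_gibbs_H_grad[OF regular_model[OF that] q]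
    by (simp add: differentiable_def mean_grad_def[abs_def])
  then obtain m' where m': "\<And>x. x \<in> S \<Longrightarrow> (mean_grad x has_derivative m' x) (at (\<theta>, l, g))"
    by metis
  let ?F' = "\<lambda>u. \<Sum>x\<in>S. data_mass xs xt t x *\<^sub>R m' x (fst u) +
    (snd u * data_velocity xs xt t x) *\<^sub>R mean_grad x (\<theta>, l, g)"
  have F: "(?F has_derivative ?F') (at ((\<theta>, l, g), t))"
    using m' by (rule has_derivative_data_mass_sum)
  have m'_0: "m' x 0 = 0" if "x \<in> S" for x
    using linear_0[OF has_derivative_linear[OF m'[OF that]]] .
  have "((\<lambda>\<phi>. ((\<phi>, l, g), t)) has_derivative (\<lambda>w. ((w, 0, 0), 0))) (at \<theta>)"
    by (intro has_derivative_Pair has_derivative_ident has_derivative_const)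
  from has_derivative_compose[OF this F]
  have "((\<lambda>\<phi>. J_grad M xs xt \<phi> l g t) has_derivative (\<lambda>w. ?F' ((w, 0, 0), 0))) (at \<theta>)"
    by (rule has_derivative_transform_within_open[OF _ open_U q(1)]) (simp add: J_grad_eq q)
  then have hess: "J_hess M xs xt \<theta> l g t *v w = ?F' ((w, 0, 0), 0)" for w
    unfolding J_hess_def hessian_def jacobian_def J_grad_def[symmetric]
    by (subst frechet_derivative_at[symmetric], assumption, subst matrix_works)
      (auto simp: linear_matrix_vector_mul_eq dest: has_derivative_linear)
  have "((\<lambda>l'. ((\<theta>, l', g), t)) has_derivative (\<lambda>h. ((0, h, 0), 0))) (at l)"
    by (intro has_derivative_Pair has_derivative_ident has_derivative_const)
  from has_derivative_compose[OF this F]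
  have l: "((\<lambda>l'. J_grad M xs xt \<theta> l' g t) has_derivative (\<lambda>h. ?F' ((0, h, 0), 0))) (at l)"
  proof (rule has_derivative_transform_within_open)
    \<comment> \<open>The slice of \<open>\<Lambda>\<close> through \<open>g\<close> is open, so
      \<open>J_grad_eq\<close> holds for all \<open>l'\<close> near \<open>l\<close>.\<close>
    show "open ((\<lambda>l'. (l', g)) -` \<Lambda>)" by (intro open_vimage open_\<Lambda> continuous_intros)
  qed (use q in \<open>auto simp: J_grad_eq\<close>)
  have "((\<lambda>g'. ((\<theta>, l, g'), t)) has_derivative (\<lambda>h. ((0, 0, h), 0))) (at g)"
    by (intro has_derivative_Pair has_derivative_ident has_derivative_const)
  from has_derivative_compose[OF this F]
  have g: "((\<lambda>g'. J_grad M xs xt \<theta> l g' t) has_derivative (\<lambda>h. ?F' ((0, 0, h), 0))) (at g)"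
  proof (rule has_derivative_transform_within_open)
    show "open ((\<lambda>g'. (l, g')) -` \<Lambda>)" by (intro open_vimage open_\<Lambda> continuous_intros)
  qed (use q in \<open>auto simp: J_grad_eq\<close>)
  have vec: "vector_derivative f (at a) = f' 1" if "(f has_derivative f') (at a)"
    for f f' :: "real \<Rightarrow> real^'n" and a
  proof (rule vector_derivative_at)
    have "f' h = h *\<^sub>R f' 1" for h
      using linear_cmul[OF has_derivative_linear[OF that], of h 1] by simp
    then show "(f has_vector_derivative f' 1) (at a)"
      unfolding has_vector_derivative_def by (intro has_derivative_eq_rhs[OF that]) (rule ext)
  qed
  \<comment> \<open>In the direction that moves time alone each \<open>m' x\<close> is evaluated at
    0 and vanishes, which leaves only the velocity of the distribution.\<close>
  have "data_integral (data_velocity xs xt t) (\<lambda>x. gibbs M x \<theta> l g (H_grad M x \<theta> l g)) = ?F' (0, 1)"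
    unfolding data_integral_velocity_eq by (simp add: m'_0 mean_grad_def)
  from that[OF F hess vec[OF l] vec[OF g] this] show thesis .
qed

text \<open>Each loss coefficient is minus the derivative of the averaged \<open>loglik\<close> in a
  direction in which one of \<open>l\<close>, \<open>g\<close>, \<open>t\<close> moves at unit speed
  and \<open>\<theta>\<close> follows with its response to that variable.\<close>

lemma loss_response:
  assumes q: "\<theta> \<in> U" "(l, g) \<in> \<Lambda>"
  obtains G where
    "((\<lambda>p. \<Sum>x\<in>S. data_mass xs xt (snd p) x *\<^sub>R mean_loglik x (fst p)) has_derivative G)
      (at ((\<theta>, l, g), t))"
    and "C_lam M xs xt \<theta> l g t = - G ((theta_lam M xs xt \<theta> l g t, 1, 0), 0)"
    and "C_gam M xs xt \<theta> l g t = - G ((theta_gam M xs xt \<theta> l g t, 0, 1), 0)"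
    and "C_t M xs xt \<theta> l g t = - G ((theta_t M xs xt \<theta> l g t, 0, 0), 1)"
proof -
  have "\<And>x. x \<in> S \<Longrightarrow> (mean_loglik x has_derivative
    (\<lambda>u. fst (snd u) * (gibbs M x \<theta> l g (H_lam M x \<theta> l g) * gibbs M x \<theta> l g (loglik M x \<theta>) -
        gibbs M x \<theta> l g (\<lambda>z. H_lam M x \<theta> l g z * loglik M x \<theta> z))
      + snd (snd u) * (gibbs M x \<theta> l g (H_gam M x \<theta> l g) * gibbs M x \<theta> l g (loglik M x \<theta>) -
        gibbs M x \<theta> l g (\<lambda>z. H_gam M x \<theta> l g z * loglik M x \<theta> z))
      + gibbs M x \<theta> l g (\<lambda>z. fst u \<bullet> H_grad M x \<theta> l g z) * gibbs M x \<theta> l g (loglik M x \<theta>)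
      - gibbs M x \<theta> l g (\<lambda>z. loglik M x \<theta> z * (fst u \<bullet> H_grad M x \<theta> l g z))
      + gibbs M x \<theta> l g (\<lambda>z. fst u \<bullet> loglik_grad M x \<theta> z))) (at (\<theta>, l, g))"
    unfolding mean_loglik_def[abs_def]
    by (rule regular_model.has_derivative_gibbs_loglik[OF regular_model q])
  note G = has_derivative_data_mass_sum[OF this, where xs = xs and xt = xt and t = t]
  show thesis
    by (rule that[OF G])
      (simp_all add: C_lam_def C_gam_def C_t_def data_expectation_eq data_integral_velocity_eq Let_def
        sum.distrib mean_loglik_def mult.commute[of "loglik M _ _ _"])
qed

end

section \<open>The velocity equations along the equilibrium path\<close>

theorem mainTheorem5:
  fixes M :: "('n::finite, 'x, 'y::finite, 'z) model"
    and xs xt :: "'x list"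
    and \<Theta> U :: "(real^'n) set"
    and \<Lambda> :: "(real \<times> real) set"
    and \<theta> :: "real \<Rightarrow> real^'n"
    and lam gam :: "real \<Rightarrow> real"
  assumes "xs \<noteq> []" and "xt \<noteq> []"
    and "set xs \<union> set xt \<subseteq> space (input_measure M)"
    and "model_on \<Theta> U M"
    and "open \<Lambda>"
    and Z_finite: "\<And>x \<phi> l g. x \<in> set xs \<union> set xt \<Longrightarrow> \<phi> \<in> U \<Longrightarrow> (l, g) \<in> \<Lambda> \<Longrightarrow>
      integrable (latent_measure M) (\<lambda>z. exp (- hamiltonian M x \<phi> l g z))"
    and regular: "\<And>x. x \<in> set xs \<union> set xt \<Longrightarrow> regular_integrals (U \<times> \<Lambda>) M x"
    and stationary: "\<And>l g t \<phi>. (l, g) \<in> \<Lambda> \<Longrightarrow> t \<in> {0..1} \<Longrightarrow>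
      \<phi> \<in> equilibrium_set \<Theta> M xs xt l g t \<Longrightarrow> J_grad M xs xt \<phi> l g t = 0"
    and "smooth_on {0..1} lam" and "smooth_on {0..1} gam"
    and "\<And>t. t \<in> {0..1} \<Longrightarrow> (lam t, gam t) \<in> \<Lambda>"
    and "smooth_on {0..1} \<theta>"
    and equilibrium: "\<And>t. t \<in> {0..1} \<Longrightarrow> \<theta> t \<in> equilibrium_set \<Theta> M xs xt (lam t) (gam t) t"
    and "\<And>t. t \<in> {0..1} \<Longrightarrow> invertible (J_hess M xs xt (\<theta> t) (lam t) (gam t) t)"
    and "\<And>t. t \<in> {0..1} \<Longrightarrow>
      ((\<lambda>s. J_grad M xs xt (\<theta> s) (lam s) (gam s) s) has_vector_derivative 0) (at t within {0..1})"
    and "\<And>t. t \<in> {0..1} \<Longrightarrow>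
      ((\<lambda>s. class_loss M xs xt (\<theta> s) (lam s) (gam s) s) has_real_derivative 0) (at t within {0..1})"
  shows "\<forall>t\<in>{0..1}.
    (let \<theta>' = vector_derivative \<theta> (at t within {0..1});
         lam' = vector_derivative lam (at t within {0..1});
         gam' = vector_derivative gam (at t within {0..1});
         \<theta>\<^sub>l = theta_lam M xs xt (\<theta> t) (lam t) (gam t) t;
         \<theta>\<^sub>g = theta_gam M xs xt (\<theta> t) (lam t) (gam t) t;
         \<theta>\<^sub>t = theta_t M xs xt (\<theta> t) (lam t) (gam t) t;
         C\<^sub>l = C_lam M xs xt (\<theta> t) (lam t) (gam t) t;
         C\<^sub>g = C_gam M xs xt (\<theta> t) (lam t) (gam t) t;
         C\<^sub>t = C_t M xs xt (\<theta> t) (lam t) (gam t) t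
     in \<theta>' = lam' *\<^sub>R \<theta>\<^sub>l + gam' *\<^sub>R \<theta>\<^sub>g + \<theta>\<^sub>t \<and>
        0 = C\<^sub>l * lam' + C\<^sub>g * gam' + C\<^sub>t \<and>
        (C\<^sub>g \<noteq> 0 \<longrightarrow>
           \<theta>' = lam' *\<^sub>R (\<theta>\<^sub>l - (C\<^sub>l / C\<^sub>g) *\<^sub>R \<theta>\<^sub>g) + (\<theta>\<^sub>t - (C\<^sub>t / C\<^sub>g) *\<^sub>R \<theta>\<^sub>g)))"
proof (intro ballI)
  fix t :: real assume t: "t \<in> {0..1}"
  have \<theta>_\<Theta>: "\<theta> s \<in> \<Theta>" if "s \<in> {0..1}" for s
    using equilibrium[OF that] by (simp add: equilibrium_set_def is_arg_min_def)
  have "open U" and sub: "\<Theta> \<subseteq> U" using assms(4) by (auto simp: model_on_def)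
  \<comment> \<open>Minimizers lie in \<open>\<Theta>\<close>, so \<open>\<theta> t\<close>
    witnesses that \<open>\<Theta>\<close> is nonempty, as required for each datum.\<close>
  interpret regular_data M xs xt \<Theta> U \<Lambda>
  proof (rule regular_data.intro)
    fix x assume x: "x \<in> set xs \<union> set xt"
    show "regular_model M \<Theta> U \<Lambda> x"
      using assms(3,4,5) Z_finite[OF x] regular[OF x] x \<theta>_\<Theta>[OF t] by unfold_locales auto
  qed (use assms \<open>open U\<close> in auto)
  have q: "\<theta> s \<in> U" "(lam s, gam s) \<in> \<Lambda>" if "s \<in> {0..1}" for s
    using \<theta>_\<Theta>[OF that] sub assms(11)[OF that] by auto
  have path: "\<theta> differentiable (at t within {0..1})" "lam differentiable (at t within {0..1})"
    "gam differentiable (at t within {0..1})"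
    using assms(9,10,12) t by (auto intro: smooth_on_differentiable)
  define v where "v = vector_derivative \<theta> (at t within {0..1})"
  define a where "a = vector_derivative lam (at t within {0..1})"
  define b where "b = vector_derivative gam (at t within {0..1})"
  define \<theta>l where "\<theta>l = theta_lam M xs xt (\<theta> t) (lam t) (gam t) t"
  define \<theta>g where "\<theta>g = theta_gam M xs xt (\<theta> t) (lam t) (gam t) t"
  define \<theta>t where "\<theta>t = theta_t M xs xt (\<theta> t) (lam t) (gam t) t"
  define Cl where "Cl = C_lam M xs xt (\<theta> t) (lam t) (gam t) t"
  define Cg where "Cg = C_gam M xs xt (\<theta> t) (lam t) (gam t) t"
  define Ct where "Ct = C_t M xs xt (\<theta> t) (lam t) (gam t) t"
  note defs = v_def a_def b_def \<theta>l_def \<theta>g_def \<theta>t_def Cl_def Cg_def Ct_def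

  obtain F where F: "((\<lambda>p. \<Sum>x\<in>set xs \<union> set xt. data_mass xs xt (snd p) x *\<^sub>R mean_grad x (fst p))
      has_derivative F) (at ((\<theta> t, lam t, gam t), t))"
    and hess: "\<And>w. J_hess M xs xt (\<theta> t) (lam t) (gam t) t *v w = F ((w, 0, 0), 0)"
    and Fl: "vector_derivative (\<lambda>l'. J_grad M xs xt (\<theta> t) l' (gam t) t) (at (lam t)) = F ((0, 1, 0), 0)"
    and Fg: "vector_derivative (\<lambda>g'. J_grad M xs xt (\<theta> t) (lam t) g' t) (at (gam t)) = F ((0, 0, 1), 0)"
    and Ft: "data_integral (data_velocity xs xt t) (\<lambda>x. gibbs M x (\<theta> t) (lam t) (gam t)
      (H_grad M x (\<theta> t) (lam t) (gam t))) = F (0, 1)"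
    using theta_response[OF q[OF t]] by blast
  \<comment> \<open>By \<open>J_grad_eq\<close> the gradient along the path is the function
    differentiated by \<open>F\<close>, and its derivative there is 0.\<close>
  have "F ((v, a, b), 1) = 0"
    unfolding v_def a_def b_def
    by (rule has_derivative_path_eq_0[OF F path _ assms(15)[OF t] t]) (simp add: J_grad_eq q)
  moreover have "F ((v, a, b), 1) = F ((v, 0, 0), 0) + a *\<^sub>R F ((0, 1, 0), 0) + b *\<^sub>R F ((0, 0, 1), 0) + F (0, 1)"
    unfolding linear_cmul[OF has_derivative_linear[OF F], symmetric]
      linear_add[OF has_derivative_linear[OF F], symmetric]
    by (simp add: zero_prod_def)
  ultimately have "J_hess M xs xt (\<theta> t) (lam t) (gam t) t *v v =
      - (a *\<^sub>R F ((0, 1, 0), 0) + b *\<^sub>R F ((0, 0, 1), 0) + F (0, 1))"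
    unfolding hess by (simp only: eq_neg_iff_add_eq_0 add.assoc)
  \<comment> \<open>Applying the inverse Hessian recovers \<open>v\<close> on the left; on the
    right, each term with its minus sign is one of the defined responses.\<close>
  from arg_cong[OF this, of "\<lambda>w. matrix_inv (J_hess M xs xt (\<theta> t) (lam t) (gam t) t) *v w"]
  have v: "v = a *\<^sub>R \<theta>l + b *\<^sub>R \<theta>g + \<theta>t"
    unfolding \<theta>l_def \<theta>g_def \<theta>t_def theta_lam_def theta_gam_def theta_t_def Fl Fg Ft
    unfolding matrix_inv_mult_vec[OF assms(14)[OF t]] linear_neg[OF matrix_vector_mul_linear]
      matrix_vector_right_distrib matrix_vector_mult_scaleR
    by simp

  obtain G where G: "((\<lambda>p. \<Sum>x\<in>set xs \<union> set xt. data_mass xs xt (snd p) x *\<^sub>R mean_loglik x (fst p))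
      has_derivative G) (at ((\<theta> t, lam t, gam t), t))"
    and Cl: "Cl = - G ((\<theta>l, 1, 0), 0)"
    and Cg: "Cg = - G ((\<theta>g, 0, 1), 0)"
    and Ct: "Ct = - G ((\<theta>t, 0, 0), 1)"
    using loss_response[OF q[OF t]] unfolding defs by blast
  \<comment> \<open>The loss is minus the averaged \<open>loglik\<close>, hence the sign.\<close>
  have "- G ((v, a, b), 1) = 0"
    unfolding v_def a_def b_def
    by (rule has_derivative_path_eq_0[OF has_derivative_minus[OF G] path _
          assms(16)[OF t, unfolded has_real_derivative_iff_has_vector_derivative] t])
      (simp add: class_loss_def data_expectation_eq mean_loglik_def)
  \<comment> \<open>The decomposition of \<open>v\<close> writes the full path velocity as a
    combination of exactly the three directions in which \<open>G\<close> gives the loss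
    coefficients.\<close>
  also have "((v, a, b), 1 :: real) = a *\<^sub>R ((\<theta>l, 1, 0), 0) + b *\<^sub>R ((\<theta>g, 0, 1), 0) + ((\<theta>t, 0, 0), 1)"
    by (simp add: v)
  finally have C: "0 = Cl * a + Cg * b + Ct"
    unfolding linear_add[OF has_derivative_linear[OF G]] linear_cmul[OF has_derivative_linear[OF G]]
    by (simp add: Cl Cg Ct algebra_simps)
  have v': "v = a *\<^sub>R (\<theta>l - (Cl / Cg) *\<^sub>R \<theta>g) + (\<theta>t - (Ct / Cg) *\<^sub>R \<theta>g)" if "Cg \<noteq> 0"
  proof -
    have "b = - (a * (Cl / Cg)) - Ct / Cg"
      using C that by (simp add: field_simps)
    then have b\<theta>g: "b *\<^sub>R \<theta>g = - (a * (Cl / Cg)) *\<^sub>R \<theta>g - (Ct / Cg) *\<^sub>R \<theta>g"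
      by (simp only: scaleR_diff_left)
    show ?thesis unfolding v b\<theta>g scaleR_diff_right scaleR_scaleR by simp
  qed
  show "let \<theta>' = vector_derivative \<theta> (at t within {0..1});
         lam' = vector_derivative lam (at t within {0..1});
         gam' = vector_derivative gam (at t within {0..1});
         \<theta>\<^sub>l = theta_lam M xs xt (\<theta> t) (lam t) (gam t) t;
         \<theta>\<^sub>g = theta_gam M xs xt (\<theta> t) (lam t) (gam t) t;
         \<theta>\<^sub>t = theta_t M xs xt (\<theta> t) (lam t) (gam t) t;
         C\<^sub>l = C_lam M xs xt (\<theta> t) (lam t) (gam t) t;
         C\<^sub>g = C_gam M xs xt (\<theta> t) (lam t) (gam t) t;
         C\<^sub>t = C_t M xs xt (\<theta> t) (lam t) (gam t) t
     in \<theta>' = lam' *\<^sub>R \<theta>\<^sub>l + gam' *\<^sub>R \<theta>\<^sub>g + \<theta>\<^sub>t \<and>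
        0 = C\<^sub>l * lam' + C\<^sub>g * gam' + C\<^sub>t \<and>
        (C\<^sub>g \<noteq> 0 \<longrightarrow>
           \<theta>' = lam' *\<^sub>R (\<theta>\<^sub>l - (C\<^sub>l / C\<^sub>g) *\<^sub>R \<theta>\<^sub>g) + (\<theta>\<^sub>t - (C\<^sub>t / C\<^sub>g) *\<^sub>R \<theta>\<^sub>g))"
    unfolding Let_def defs[symmetric] using v C v' by (intro conjI impI)
qed

end
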